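(* Let $0<\alpha<1$, $\psi\in C^{1,\alpha}(\overline{B_1'})$, and $\Omega^\pm,\Gamma$ defined by $\psi$. Let $f^\pm\in C(\Omega^\pm)\cap L^\infty(B_1)$ and $g\in L^\infty(\Gamma)$. Suppose $u$ satisfies $u\in\overline S_{\lambda,\Lambda}(f^\pm)$ in $\Omega^\pm$ and $u^+_\nu-u^-_\nu\le g$ on $\Gamma$ in the viscosity sense. Then $$\sup_{B_1}u_-\le\sup_{\partial B_1}u_-+C\big(\max_\Gamma g_++\|f^-_+\|_{L^n(\Omega^-)}+\|f^+_+\|_{L^n(\Omega^+)}\big),$$ where $C>0$ depends only on $n,\lambda,\Lambda,\alpha$ and $[\psi]_{C^{1,\alpha}}$.
   Context: $n\ge2$, $x=(x',x_n)$; $B_1\subset\mathbb R^n$, $B_1'\subset\mathbb R^{n-1}$ unit balls. For a function $v$: $v_-=-\min\{0,v\}$, $v_+=\max\{0,v\}$; $f^\pm_+$ is the positive part of $f^\pm$. Pucci operator $\mathcal M^-_{\lambda,\Lambda}(M)=\lambda\sum_{e_i>0}e_i+\Lambda\sum_{e_i<0}e_i$ ($e_i$ eigenvalues of $M$); $u\in\overline S_{\lambda,\Lambda}(f^\pm)$ in $\Omega^\pm$ means $u$ is lower semicontinuous and $\mathcal M^-_{\lambda,\Lambda}(D^2u)\le f^+$ in $\Omega^+$ and $\le f^-$ in $\Omega^-$ in the viscosity sense. Interface: $\Omega^+=B_1\cap\{x_n>\psi(x')\}$, $\Omega^-=B_1\cap\{x_n<\psi(x')\}$, $\Gamma=B_1\cap\{x_n=\psi(x')\}$,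 $\nu$ unit normal to $\Gamma$ pointing into $\Omega^+$. "$u^+_\nu-u^-_\nu\le g$ on $\Gamma$ in the viscosity sense" means: whenever $x_0\in\Gamma$ and a continuous $\varphi\in C^1(B_\delta(x_0)\cap\overline{\Omega^+})\cap C^1(B_\delta(x_0)\cap\overline{\Omega^-})$ touches $u$ from below at $x_0$, then $\varphi^+_\nu(x_0)-\varphi^-_\nu(x_0)\le g(x_0)$, $\varphi^\pm$ the restrictions of $\varphi$ to $\overline{\Omega^\pm}$. *)

theory Defs
  imports "HOL-Analysis.Analysis"
begin

text \<open>Points of R^n are vectors indexed by 'm option: the coordinate None is x_n,
  the coordinates Some i form x' in R^(n-1) = real^'m.  Hence n = CARD('m) + 1 >= 2.\<close>

definition xprime :: "real^('m::finite option) \<Rightarrow> real^'m" where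
  "xprime x = (\<chi> i. x $ Some i)"

definition xlast :: "real^('m::finite option) \<Rightarrow> real" where
  "xlast x = x $ None"

definition lsc_on :: "'a::metric_space set \<Rightarrow> ('a \<Rightarrow> real) \<Rightarrow> bool" where
  "lsc_on S u \<longleftrightarrow> (\<forall>x\<in>S. \<forall>t. t < u x \<longrightarrow>
      (\<exists>e>0. \<forall>y\<in>S. dist y x < e \<longrightarrow> t < u y))"

definition grad_within :: "(real^'a::finite \<Rightarrow> real) \<Rightarrow> (real^'a) set \<Rightarrow> real^'a \<Rightarrow> real^'a"
  where "grad_within \<psi> S x = (\<chi> i. frechet_derivative \<psi> (at x within S) (axis i 1))"

definition C1alpha_cball :: "real \<Rightarrow> (real^'m::finite \<Rightarrow> real) \<Rightarrow> bool" where
  "C1alpha_cball \<alpha> \<psi> \<longleftrightarrow>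
     (\<forall>x\<in>cball 0 1. \<psi> differentiable (at x within cball 0 1)) \<and>
     (\<exists>K. \<forall>x\<in>cball 0 1. \<forall>y\<in>cball 0 1. x \<noteq> y \<longrightarrow>
        norm (grad_within \<psi> (cball 0 1) x - grad_within \<psi> (cball 0 1) y) / dist x y powr \<alpha> \<le> K)"

definition C1alpha_seminorm :: "real \<Rightarrow> (real^'m::finite \<Rightarrow> real) \<Rightarrow> real" where
  "C1alpha_seminorm \<alpha> \<psi> =
     Sup {norm (grad_within \<psi> (cball 0 1) x - grad_within \<psi> (cball 0 1) y) / dist x y powr \<alpha>
          | x y. x \<in> cball 0 1 \<and> y \<in> cball 0 1 \<and> x \<noteq> y}"

definition OmegaP :: "(real^'m::finite \<Rightarrow> real) \<Rightarrow> (real^('m option)) set" where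
  "OmegaP \<psi> = ball 0 1 \<inter> {x. xlast x > \<psi> (xprime x)}"

definition OmegaM :: "(real^'m::finite \<Rightarrow> real) \<Rightarrow> (real^('m option)) set" where
  "OmegaM \<psi> = ball 0 1 \<inter> {x. xlast x < \<psi> (xprime x)}"

definition Gamma :: "(real^'m::finite \<Rightarrow> real) \<Rightarrow> (real^('m option)) set" where
  "Gamma \<psi> = ball 0 1 \<inter> {x. xlast x = \<psi> (xprime x)}"

text \<open>Unit normal to Gamma at x, pointing into Omega^+: (-grad psi(x'), 1)/sqrt(1+|grad psi(x')|^2).\<close>
definition normal :: "(real^'m::finite \<Rightarrow> real) \<Rightarrow> real^('m option) \<Rightarrow> real^('m option)" where
  "normal \<psi> x = (let G = grad_within \<psi> (cball 0 1) (xprime x);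
                     s = sqrt (1 + (norm G)\<^sup>2)
                 in (\<chi> j. case j of None \<Rightarrow> 1 / s | Some i \<Rightarrow> - (G $ i) / s))"

text \<open>Minimal Pucci operator: lambda * (sum of positive eigenvalues) + Lambda * (sum of negative
  eigenvalues), the eigenvalues (with multiplicity) read off an orthogonal diagonalization.\<close>
definition pucci_min :: "real \<Rightarrow> real \<Rightarrow> real^'n::finite^'n \<Rightarrow> real" where
  "pucci_min lam Lam M = (SOME v. \<exists>Q D. orthogonal_matrix Q \<and>
       (\<forall>i j. i \<noteq> j \<longrightarrow> D $ i $ j = 0) \<and> M = Q ** D ** transpose Q \<and>
       v = lam * (\<Sum>i | D $ i $ i > 0. D $ i $ i) + Lam * (\<Sum>i | D $ i $ i < 0. D $ i $ i))"

definition C2_hessian :: "(real^'n::finite \<Rightarrow> real) \<Rightarrow> real^'n \<Rightarrow> real \<Rightarrow> real^'n^'n \<Rightarrow> bool" where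
  "C2_hessian \<phi> x0 \<delta> H \<longleftrightarrow> (\<exists>D1 D2.
     (\<forall>x\<in>ball x0 \<delta>. (\<phi> has_derivative (\<lambda>h. D1 x \<bullet> h)) (at x) \<and>
                     (D1 has_derivative (\<lambda>h. D2 x *v h)) (at x)) \<and>
     continuous_on (ball x0 \<delta>) D2 \<and> H = D2 x0)"

text \<open>u in S-bar_{lambda,Lambda}(f) in the open set Omega, in the viscosity sense
  (lower semicontinuity is required separately).\<close>
definition visc_super :: "real \<Rightarrow> real \<Rightarrow> (real^'n::finite) set \<Rightarrow> (real^'n \<Rightarrow> real) \<Rightarrow> (real^'n \<Rightarrow> real) \<Rightarrow> bool" where
  "visc_super lam Lam \<Omega> f u \<longleftrightarrow>
     (\<forall>x0\<in>\<Omega>. \<forall>\<phi> \<delta> H. \<delta> > 0 \<and> C2_hessian \<phi> x0 \<delta> H \<and> \<phi> x0 = u x0 \<and>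
        (\<forall>y\<in>ball x0 \<delta> \<inter> \<Omega>. \<phi> y \<le> u y)
        \<longrightarrow> pucci_min lam Lam H \<le> f x0)"

definition C1_on_with :: "(real^'n::finite \<Rightarrow> real) \<Rightarrow> (real^'n) set \<Rightarrow> (real^'n \<Rightarrow> real^'n) \<Rightarrow> bool" where
  "C1_on_with \<phi> S G \<longleftrightarrow>
     (\<forall>x\<in>S. (\<phi> has_derivative (\<lambda>h. G x \<bullet> h)) (at x within S)) \<and> continuous_on S G"

definition visc_transmission :: "(real^'m::finite \<Rightarrow> real) \<Rightarrow> (real^('m option) \<Rightarrow> real)
    \<Rightarrow> (real^('m option) \<Rightarrow> real) \<Rightarrow> bool" where
  "visc_transmission \<psi> g u \<longleftrightarrow>
     (\<forall>x0\<in>Gamma \<psi>. \<forall>\<phi> \<delta> Gp Gm. \<delta> > 0 \<and> continuous_on (ball x0 \<delta>) \<phi> \<and>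
        C1_on_with \<phi> (ball x0 \<delta> \<inter> closure (OmegaP \<psi>)) Gp \<and>
        C1_on_with \<phi> (ball x0 \<delta> \<inter> closure (OmegaM \<psi>)) Gm \<and>
        \<phi> x0 = u x0 \<and> (\<forall>y\<in>ball x0 \<delta> \<inter> ball 0 1. \<phi> y \<le> u y)
        \<longrightarrow> Gp x0 \<bullet> normal \<psi> x0 - Gm x0 \<bullet> normal \<psi> x0 \<le> g x0)"

definition Ln_norm_pos :: "(real^'n::finite) set \<Rightarrow> (real^'n \<Rightarrow> real) \<Rightarrow> real" where
  "Ln_norm_pos \<Omega> f = (LINT x:\<Omega>|lborel. (max 0 (f x)) ^ CARD('n)) powr (1 / real CARD('n))"

end

theory Submission
  imports Defs
begin

text \<open>Let \<open>D\<close> be the normalised vertical distance to the graph. A supremum of explicit functions, one for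
  each point of the graph, gives a bounded \<open>W \<ge> 0\<close> that vanishes below the graph, is at least \<open>D / 2\<close>
  just above it, and is touched from below everywhere by paraboloids with Pucci value bounded below.
  If \<open>G\<close> is slightly larger than a multiple of \<open>sup g\<^sub>+\<close>, a supporting plane from below
  of \<open>v = u + const - G W\<close> cannot touch \<open>v\<close> on the interface, since adding \<open>(G / 2) D\<^sub>+\<close> to it would give a test
  function for \<open>u\<close> with too large a jump of the normal derivative. Hence all slopes in a ball, whose
  radius is comparable to the depth of \<open>v\<close>, are attained at contact points off the interface. There the
  contact slope is locally Lipschitz with constant controlled by the right-hand side, so a covering
  argument bounds the volume of the ball of slopes by the \<open>n\<close>-th power of the \<open>L\<^sup>n\<close> norm, as in the
  Aleksandrov--Bakelman--Pucci estimate.\<close>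

section \<open>The minimal Pucci operator on quadratic test functions\<close>

text \<open>The obstacle is the low regularity of \<open>\<psi>\<close>: the kinked function
  \<open>D\<^sub>+\<close> that would absorb the jump has no second derivatives, and straightening
  the graph would differentiate \<open>\<psi>\<close> twice. A supremum is robust here: where one
  member attains it, every paraboloid touching that member from below also touches the supremum.
  Adding \<open>G\<close> times such a paraboloid to one below \<open>v\<close> gives a single
  quadratic test function for \<open>u\<close>. So the Pucci operator is only evaluated on
  quadratics, and neither a convex envelope nor second derivatives of \<open>v\<close> appear. The
  final constant may depend on the seminorm of \<open>\<psi>\<close> but not on the size of its
  gradient. Over the unit ball the gradient differs from its value at 0 by at most the seminorm, so
  dividing by the slope factor at 0 removes that size. What depends on \<open>\<psi>\<close> in
  other ways, such as the radius on which \<open>W\<close> is at least \<open>D / 2\<close>, is used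
  only locally. The bound on the jump has to be strict to exclude contact, and the data oscillate on
  grid cells; both cost an \<epsilon> that is removed at the end.\<close>

lemma symmetric_eigenvector_exists:
  fixes f :: "'a::euclidean_space \<Rightarrow> 'a"
  assumes lf: "linear f" and sym: "\<And>x y. f x \<bullet> y = x \<bullet> f y"
    and S: "subspace S" "f ` S \<subseteq> S" "S \<noteq> {0}"
  shows "\<exists>e\<in>S. norm e = 1 \<and> (\<exists>c. f e = c *\<^sub>R e)"
proof -
  have z: "0 \<in> S" using S(1) subspace_0 by blast
  then obtain a where a: "a \<in> S" "a \<noteq> 0" using S(3) by blast
  define C where "C = S \<inter> sphere 0 1"
  have comp: "compact C" unfolding C_def
    using S(1) by (intro closed_Int_compact closed_subspace) auto
  have "a /\<^sub>R norm a \<in> C" unfolding C_def using a S(1) by (auto intro: subspace_scale)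
  then have ne: "C \<noteq> {}" by auto
  have lin: "continuous_on C f" using lf by (simp add: linear_continuous_on linear_conv_bounded_linear)
  have "continuous_on C (\<lambda>x. x \<bullet> f x)" using lin by (intro continuous_on_inner continuous_on_id)
  then obtain e where e: "e \<in> C" "\<And>y. y \<in> C \<Longrightarrow> y \<bullet> f y \<le> e \<bullet> f e"
    using continuous_attains_sup[OF comp ne, of "\<lambda>x. x \<bullet> f x"] by blast
  define c where "c = e \<bullet> f e"
  have eS: "e \<in> S" "norm e = 1" using e(1) by (auto simp: C_def)
  have ub: "y \<bullet> f y \<le> c * (y \<bullet> y)" if "y \<in> S" for y
  proof (cases "y = 0")
    case False
    then have "y /\<^sub>R norm y \<in> C" unfolding C_def using that S(1) by (auto intro: subspace_scale)
    from e(2)[OF this] have "(y \<bullet> f y) / (norm y)\<^sup>2 \<le> c"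
      using lf by (simp add: c_def linear_cmul power2_eq_square field_simps)
    then show ?thesis using False by (simp add: field_simps power2_norm_eq_inner)
  qed (simp add: linear_0[OF lf])
  \<comment> \<open>\<open>e\<close> maximises the Rayleigh quotient on \<open>S\<close>. The
    residual \<open>w\<close> is orthogonal to \<open>e\<close>, and moving from \<open>e\<close>
    along \<open>w\<close> raises the quotient to first order unless \<open>w = 0\<close>.\<close>
  define w where "w = f e - c *\<^sub>R e"
  have wS: "w \<in> S" unfolding w_def using eS S by (intro subspace_diff subspace_scale) auto
  have ee: "e \<bullet> e = 1" using eS by (simp add: norm_eq_1)
  have we: "w \<bullet> e = 0" by (simp add: w_def inner_diff_left ee c_def inner_commute[of "f e" e])
  have wf: "w \<bullet> f e = w \<bullet> w"
  proof -
    have "f e = w + c *\<^sub>R e" by (simp add: w_def)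
    then have "w \<bullet> f e = w \<bullet> w + c * (w \<bullet> e)" by (simp only: inner_add_right inner_scaleR_right)
    then show ?thesis by (simp add: we)
  qed
  have ineq: "2 * t * (w \<bullet> w) \<le> t\<^sup>2 * (c * (w \<bullet> w) - w \<bullet> f w)" for t
  proof -
    have "e + t *\<^sub>R w \<in> S" using eS wS S by (intro subspace_add subspace_scale) auto
    from ub[OF this] have "(e + t *\<^sub>R w) \<bullet> (f e + t *\<^sub>R f w) \<le> c * ((e + t *\<^sub>R w) \<bullet> (e + t *\<^sub>R w))"
      by (simp only: linear_add[OF lf] linear_cmul[OF lf])
    moreover have "e \<bullet> f w = w \<bullet> w" using wf sym[of e w] by (simp only: inner_commute[of "f e"])
    moreover have "e \<bullet> w = 0" using we by (simp only: inner_commute)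
    ultimately show ?thesis
      using we wf ee by (simp add: inner_add_left inner_add_right c_def[symmetric] power2_eq_square)
        (simp add: algebra_simps)
  qed
  have "w \<bullet> w = 0"
  proof (rule ccontr)
    assume "w \<bullet> w \<noteq> 0"
    then have pos: "w \<bullet> w > 0" by simp
    define k where "k = c * (w \<bullet> w) - w \<bullet> f w"
    \<comment> \<open>Small enough that \<open>t * k \<le> w \<bullet> w\<close>, whereas maximality
      demands \<open>2 * (w \<bullet> w) \<le> t * k\<close>.\<close>
    define t where "t = (w \<bullet> w) / (1 + \<bar>k\<bar>)"
    have tp: "t > 0" using pos by (simp add: t_def)
    have "2 * (w \<bullet> w) \<le> t * k"
      using ineq[of t] tp by (simp add: k_def[symmetric] power2_eq_square)
    also have "t * k \<le> t * (1 + \<bar>k\<bar>)" using tp by (intro mult_left_mono) auto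
    also have "\<dots> = w \<bullet> w" by (simp add: t_def)
    finally show False using pos by simp
  qed
  then have "f e = c *\<^sub>R e" by (simp add: w_def)
  then show ?thesis using eS by blast
qed

text \<open>An orthonormal set of eigenvectors of maximal size spans: by symmetry its orthogonal
  complement is invariant under \<open>f\<close>, so a nonzero complement would contain one more
  eigenvector.\<close>

lemma symmetric_orthonormal_eigenbasis:
  fixes f :: "'a::euclidean_space \<Rightarrow> 'a"
  assumes lf: "linear f" and sym: "\<And>x y. f x \<bullet> y = x \<bullet> f y"
  shows "\<exists>B. finite B \<and> card B = DIM('a) \<and> pairwise orthogonal B \<and>
      (\<forall>b\<in>B. norm b = 1 \<and> (\<exists>c. f b = c *\<^sub>R b))"
proof -
  define P where "P B \<longleftrightarrow> pairwise orthogonal B \<and>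
      (\<forall>b\<in>B. norm b = 1 \<and> (\<exists>c. f b = c *\<^sub>R b))" for B
  have ind: "independent B" if "P B" for B
    using that by (intro pairwise_orthogonal_independent) (auto simp: P_def)
  have fin: "finite B" and le: "card B \<le> DIM('a)" if "P B" for B
    using independent_bound[OF ind[OF that]] by auto
  have "P {}" by (simp add: P_def)
  moreover have "\<forall>B. P B \<longrightarrow> card B < Suc (DIM('a))" using le by (simp add: less_Suc_eq_le)
  ultimately have "\<exists>B. P B \<and> (\<forall>B'. P B' \<longrightarrow> card B' \<le> card B)"
    by (rule Lattices_Big.ex_has_greatest_nat)
  then obtain B where B: "P B" "\<And>B'. P B' \<Longrightarrow> card B' \<le> card B" by auto
  define S where "S = {x. \<forall>b\<in>B. b \<bullet> x = 0}"
  have sub: "subspace S" unfolding S_def subspace_def by (auto simp: inner_add_right)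
  have inv: "f ` S \<subseteq> S"
  proof
    fix y assume "y \<in> f ` S"
    then obtain x where x: "x \<in> S" "y = f x" by blast
    have "b \<bullet> f x = 0" if b: "b \<in> B" for b
    proof -
      obtain c where c: "f b = c *\<^sub>R b" using B(1) b by (auto simp: P_def)
      have "b \<bullet> f x = c * (b \<bullet> x)" using sym[of b x] c by simp
      then show ?thesis using x(1) b by (simp add: S_def)
    qed
    then show "y \<in> S" by (simp add: S_def x(2))
  qed
  have S0: "S = {0}"
  proof (rule ccontr)
    assume "S \<noteq> {0}"
    from symmetric_eigenvector_exists[OF lf sym sub inv this]
    obtain e where e: "e \<in> S" "norm e = 1" "\<exists>c. f e = c *\<^sub>R e" by blast
    have "e \<notin> B" using e(1,2) by (auto simp: S_def)
    moreover have "P (insert e B)" using B(1) e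
      by (auto simp: P_def pairwise_insert orthogonal_def S_def inner_commute)
    ultimately show False using B(2)[of "insert e B"] fin[OF B(1)] by simp
  qed
  have "x \<in> span B" for x
  proof -
    define y where "y = x - (\<Sum>b\<in>B. (b \<bullet> x) *\<^sub>R b)"
    have "a \<bullet> y = 0" if a: "a \<in> B" for a
    proof -
      have "a \<bullet> (\<Sum>b\<in>B. (b \<bullet> x) *\<^sub>R b) = (\<Sum>b\<in>B. (b \<bullet> x) * (a \<bullet> b))"
        by (simp add: inner_sum_right)
      also have "\<dots> = (\<Sum>b\<in>B. if b = a then a \<bullet> x else 0)"
        using B(1) a by (intro sum.cong) (auto simp: P_def pairwise_def orthogonal_def norm_eq_1)
      also have "\<dots> = a \<bullet> x" using a fin[OF B(1)] by simp
      finally show ?thesis by (simp add: y_def inner_diff_right)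
    qed
    then have "y \<in> S" by (simp add: S_def)
    then have "x = (\<Sum>b\<in>B. (b \<bullet> x) *\<^sub>R b)" using S0 by (simp add: y_def)
    also have "\<dots> \<in> span B" by (intro span_sum span_scale span_base)
    finally show ?thesis .
  qed
  then have "span B = UNIV" by auto
  then have "card B = DIM('a)"
    using dim_span_eq_card_independent[OF ind[OF B(1)]] by simp
  then show ?thesis using B(1) fin[OF B(1)] by (auto simp: P_def)
qed

lemma symmetric_matrix_diagonalizable:
  fixes M :: "real^'n::finite^'n"
  assumes sym: "transpose M = M"
  shows "\<exists>Q D. orthogonal_matrix Q \<and> (\<forall>i j. i \<noteq> j \<longrightarrow> D $ i $ j = 0) \<and> M = Q ** D ** transpose Q"
proof -
  have "linear ((*v) M)" by simp
  moreover have "(M *v x) \<bullet> y = x \<bullet> (M *v y)" for x y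
    using dot_lmul_matrix[of x M y] transpose_matrix_vector[of M x] by (simp only: sym)
  ultimately obtain B where B: "finite B" "card B = CARD('n)" "pairwise orthogonal B"
      "\<And>b. b \<in> B \<Longrightarrow> norm b = 1 \<and> (\<exists>c. M *v b = c *\<^sub>R b)"
    using symmetric_orthonormal_eigenbasis[of "(*v) M"] by auto
  obtain q :: "'n \<Rightarrow> real^'n" where q: "bij_betw q UNIV B"
    using finite_same_card_bij[of "UNIV::'n set" B] B by auto
  have qB: "q i \<in> B" for i using q by (auto simp: bij_betw_def)
  have "\<forall>i. \<exists>c. M *v q i = c *\<^sub>R q i" using B(4) qB by blast
  then obtain c where c: "\<And>i. M *v q i = c i *\<^sub>R q i" by metis
  define Q :: "real^'n^'n" where "Q = (\<chi> i j. q j $ i)"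
  define D :: "real^'n^'n" where "D = (\<chi> i j. if i = j then c i else 0)"
  have qq: "q i \<bullet> q j = (if i = j then 1 else 0)" for i j
  proof (cases "i = j")
    case True
    then show ?thesis using B(4)[OF qB[of i]] by (simp add: norm_eq_1)
  next
    case False
    then have "q i \<noteq> q j" using q by (auto simp: bij_betw_def inj_def)
    then show ?thesis using B(3) qB[of i] qB[of j] False by (auto simp: pairwise_def orthogonal_def)
  qed
  have tq: "transpose Q ** Q = mat 1"
    using qq by (simp add: vec_eq_iff matrix_matrix_mult_def transpose_def Q_def mat_def inner_vec_def)
  have orth: "orthogonal_matrix Q" using tq by (simp add: orthogonal_matrix)
  then have qt: "Q ** transpose Q = mat 1" by (simp add: orthogonal_matrix_def)
  have MQ: "M ** Q = Q ** D"
  proof -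
    have "(M ** Q) $ i $ j = (Q ** D) $ i $ j" for i j
    proof -
      have "(M ** Q) $ i $ j = (M *v q j) $ i"
        by (simp add: matrix_matrix_mult_def matrix_vector_mult_def Q_def)
      also have "\<dots> = c j * q j $ i" by (simp add: c)
      also have "\<dots> = (Q ** D) $ i $ j"
        by (simp add: matrix_matrix_mult_def Q_def D_def if_distrib cong: if_cong)
      finally show ?thesis .
    qed
    then show ?thesis by (simp add: vec_eq_iff)
  qed
  have "M = M ** (Q ** transpose Q)" by (simp add: qt)
  also have "\<dots> = Q ** D ** transpose Q" by (simp add: matrix_mul_assoc MQ)
  finally show ?thesis using orth by (intro exI[of _ Q] exI[of _ D]) (auto simp: D_def)
qed

text \<open>\<open>pucci_min\<close> chooses some diagonalization, so one must exist and the bound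
  must hold for all of them. In the orthonormal columns of \<open>Q\<close> each eigenvalue is a
  nonnegative part minus \<open>c3\<close>. Whichever of \<open>lam\<close> and \<open>Lam\<close>
  weights it, the nonnegative part receives at least \<open>lam\<close> and \<open>c3\<close> at
  most \<open>Lam\<close>; Parseval then sums the squares.\<close>

lemma pucci_min_lower_bound:
  fixes M :: "real^'n::finite^'n"
  assumes lam: "0 < lam" "lam \<le> Lam" and c: "c1 \<ge> 0" "c2 \<ge> 0" "c3 \<ge> 0"
    and M: "\<And>h. M *v h = (c1 * (e \<bullet> h)) *\<^sub>R e + (c2 * (N \<bullet> h)) *\<^sub>R N - c3 *\<^sub>R h"
  shows "lam * (c1 * (norm e)\<^sup>2 + c2 * (norm N)\<^sup>2) - Lam * real CARD('n) * c3 \<le> pucci_min lam Lam M"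
proof -
  have ent: "M $ i $ j = (M *v axis j 1) $ i" for i j
    by (simp add: matrix_vector_mul_component inner_axis)
  have "M $ i $ j = M $ j $ i" for i j
    unfolding ent M by (simp add: inner_axis) (simp add: axis_def)
  then have "transpose M = M" by (simp add: transpose_def vec_eq_iff)
  from symmetric_matrix_diagonalizable[OF this]
  have "\<exists>v Q D. orthogonal_matrix Q \<and>
       (\<forall>i j. i \<noteq> j \<longrightarrow> D $ i $ j = 0) \<and> M = Q ** D ** transpose Q \<and>
       v = lam * (\<Sum>i | D $ i $ i > 0. D $ i $ i) + Lam * (\<Sum>i | D $ i $ i < 0. D $ i $ i)" by blast
  from someI_ex[OF this, folded pucci_min_def] obtain Q D where Q: "orthogonal_matrix Q"
      "M = Q ** D ** transpose Q" and
      v: "pucci_min lam Lam M = lam * (\<Sum>i | D $ i $ i > 0. D $ i $ i) + Lam * (\<Sum>i | D $ i $ i < 0. D $ i $ i)"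
    by blast
  define q where "q i = Q *v axis i 1" for i
  have tq: "transpose Q ** Q = mat 1" and qt: "Q ** transpose Q = mat 1"
    using Q(1) by (auto simp: orthogonal_matrix_def)
  have D: "D = transpose Q ** M ** Q"
  proof -
    have "transpose Q ** M ** Q = (transpose Q ** Q) ** D ** (transpose Q ** Q)"
      by (simp only: Q(2) matrix_mul_assoc)
    then show ?thesis by (simp add: tq)
  qed
  have ip: "(transpose Q *v x) $ i = x \<bullet> q i" for x i
    by (simp add: q_def inner_commute[of x] matrix_vector_mul_component inner_axis
        dot_lmul_matrix[symmetric] matrix_vector_mult_basis column_def inner_vec_def matrix_vector_mult_def transpose_def axis_def if_distrib mult.commute cong: if_cong)
  have nq: "(\<Sum>i\<in>UNIV. (x \<bullet> q i)\<^sup>2) = (norm x)\<^sup>2" for x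
  proof -
    have "orthogonal_transformation ((*v) (transpose Q))"
      using Q(1) by (simp add: orthogonal_transformation_matrix)
    then have "norm (transpose Q *v x) = norm x" by (simp add: orthogonal_transformation)
    then have "(norm x)\<^sup>2 = (transpose Q *v x) \<bullet> (transpose Q *v x)"
      by (simp add: power2_norm_eq_inner[symmetric])
    also have "\<dots> = (\<Sum>i\<in>UNIV. ((transpose Q *v x) $ i)\<^sup>2)"
      by (simp add: inner_vec_def power2_eq_square)
    finally have "(norm x)\<^sup>2 = (\<Sum>i\<in>UNIV. ((transpose Q *v x) $ i)\<^sup>2)" .
    then show ?thesis by (simp only: ip)
  qed
  have qn: "q i \<bullet> q i = 1" for i
  proof -
    have "q i \<bullet> q i = (transpose Q *v q i) $ i" by (simp only: ip)
    also have "\<dots> = 1" by (simp add: q_def matrix_vector_mul_assoc tq)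
    finally show ?thesis .
  qed
  have Dii: "D $ i $ i = c1 * (e \<bullet> q i)\<^sup>2 + c2 * (N \<bullet> q i)\<^sup>2 - c3" for i
  proof -
    have "D $ i $ i = (transpose Q *v (M *v q i)) $ i"
      by (simp add: D q_def matrix_vector_mul_assoc matrix_mul_assoc matrix_vector_mul_component inner_axis)
    also have "\<dots> = (M *v q i) \<bullet> q i" by (simp only: ip)
    also have "\<dots> = c1 * (e \<bullet> q i)\<^sup>2 + c2 * (N \<bullet> q i)\<^sup>2 - c3"
      by (simp add: M inner_add_left inner_diff_left qn power2_eq_square)
    finally show ?thesis .
  qed
  define a where "a i = (if D $ i $ i > 0 then lam else Lam)" for i
  have "pucci_min lam Lam M = (\<Sum>i\<in>UNIV. a i * D $ i $ i)"
  proof -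
    have "(\<Sum>i\<in>UNIV. a i * D $ i $ i) =
      (\<Sum>i\<in>UNIV. (if D $ i $ i > 0 then lam * D $ i $ i else 0) + (if D $ i $ i < 0 then Lam * D $ i $ i else 0))"
      by (intro sum.cong) (auto simp: a_def)
    also have "\<dots> = pucci_min lam Lam M"
      by (simp add: v sum.distrib sum_distrib_left sum.inter_filter[symmetric])
    finally show ?thesis by simp
  qed
  moreover have "a i * D $ i $ i \<ge> lam * (c1 * (e \<bullet> q i)\<^sup>2 + c2 * (N \<bullet> q i)\<^sup>2) - Lam * c3" for i
  proof -
    define X where "X = c1 * (e \<bullet> q i)\<^sup>2 + c2 * (N \<bullet> q i)\<^sup>2"
    have X: "X \<ge> 0" using c by (simp add: X_def)
    have "lam * c3 \<le> Lam * c3" "lam * X \<le> Lam * X" using lam c X by (auto intro: mult_right_mono)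
    then show ?thesis unfolding Dii a_def X_def[symmetric] by (simp add: algebra_simps)
  qed
  ultimately have "(\<Sum>i\<in>UNIV. lam * (c1 * (e \<bullet> q i)\<^sup>2 + c2 * (N \<bullet> q i)\<^sup>2) - Lam * c3) \<le> pucci_min lam Lam M"
    by (simp add: sum_mono)
  then show ?thesis
    by (simp add: sum.distrib sum_subtractf sum_distrib_left[symmetric] nq distrib_left mult.assoc mult.left_commute)
qed

lemma C2_hessian_quadratic:
  fixes H :: "real^'n::finite^'n"
  assumes H: "\<And>h. H *v h = (2 * c1 * (e \<bullet> h)) *\<^sub>R e + (2 * c2 * (N \<bullet> h)) *\<^sub>R N - (2 * c3) *\<^sub>R h"
  shows "C2_hessian (\<lambda>y. k + p \<bullet> (y - x0) + c1 * (e \<bullet> (y - x0))\<^sup>2 + c2 * (N \<bullet> (y - x0))\<^sup>2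
            - c3 * ((y - x0) \<bullet> (y - x0))) x0 \<delta> H"
  unfolding C2_hessian_def
proof (intro exI[of _ "\<lambda>y. p + H *v (y - x0)"] exI[of _ "\<lambda>_. H"] conjI ballI)
  fix x
  have d: "((\<lambda>y. y - x0) has_derivative (\<lambda>h. h)) (at x)"
    using has_derivative_diff[OF has_derivative_ident has_derivative_const[of x0]] by simp
  have di: "((\<lambda>y. v \<bullet> (y - x0)) has_derivative (\<lambda>h. v \<bullet> h)) (at x)" for v
    by (rule has_derivative_inner_right[OF d])
  have ds: "((\<lambda>y. c * (v \<bullet> (y - x0))\<^sup>2) has_derivative (\<lambda>h. c * (2 * (v \<bullet> (x - x0)) * (v \<bullet> h)))) (at x)" for c v
    using has_derivative_mult_right[OF has_derivative_power[OF di[of v], of 2], of c]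
    by (simp add: mult_ac)
  have dn: "((\<lambda>y. c3 * ((y - x0) \<bullet> (y - x0))) has_derivative (\<lambda>h. c3 * (2 * ((x - x0) \<bullet> h)))) (at x)"
    using has_derivative_mult_right[OF has_derivative_inner[OF d d], of c3]
    by (simp add: inner_commute)
  have eq: "(p + H *v (x - x0)) \<bullet> h = 0 + p \<bullet> h + c1 * (2 * (e \<bullet> (x - x0)) * (e \<bullet> h))
      + c2 * (2 * (N \<bullet> (x - x0)) * (N \<bullet> h)) - c3 * (2 * ((x - x0) \<bullet> h))" for h
    unfolding H inner_add_left inner_diff_left inner_scaleR_left by (simp add: mult_ac)
  show "((\<lambda>y. k + p \<bullet> (y - x0) + c1 * (e \<bullet> (y - x0))\<^sup>2 + c2 * (N \<bullet> (y - x0))\<^sup>2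
            - c3 * ((y - x0) \<bullet> (y - x0))) has_derivative (\<lambda>h. (p + H *v (x - x0)) \<bullet> h)) (at x)"
    unfolding eq
    by (intro has_derivative_add has_derivative_diff has_derivative_const di ds dn)
  have "((\<lambda>y. H *v (y - x0)) has_derivative (\<lambda>h. H *v h)) (at x)"
    by (rule bounded_linear.has_derivative[OF matrix_vector_mul_bounded_linear d])
  from has_derivative_add[OF has_derivative_const[of p] this]
  show "((\<lambda>y. p + H *v (y - x0)) has_derivative (*v) H) (at x)"
    by simp
qed auto

text \<open>The form in which the interior viscosity condition is used. Two rank-one terms are
  needed: \<open>e\<close> serves the barrier that compares slopes, \<open>N\<close> the paraboloid
  below \<open>W\<close>.\<close>

lemma visc_super_quadratic:
  fixes u :: "real^'n::finite \<Rightarrow> real"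
  assumes lam: "0 < lam" "lam \<le> Lam" and c: "c1 \<ge> 0" "c2 \<ge> 0" "c3 \<ge> 0"
    and vs: "visc_super lam Lam \<Omega> f u" and x0: "x0 \<in> \<Omega>" and \<delta>: "\<delta> > 0"
    and touch: "\<And>y. y \<in> ball x0 \<delta> \<inter> \<Omega> \<Longrightarrow> u x0 + p \<bullet> (y - x0) + c1 * (e \<bullet> (y - x0))\<^sup>2
            + c2 * (N \<bullet> (y - x0))\<^sup>2 - c3 * ((y - x0) \<bullet> (y - x0)) \<le> u y"
  shows "2 * (lam * (c1 * (norm e)\<^sup>2 + c2 * (norm N)\<^sup>2) - Lam * real CARD('n) * c3) \<le> f x0"
proof -
  define H :: "real^'n^'n" where
    "H = matrix (\<lambda>h. (2 * c1 * (e \<bullet> h)) *\<^sub>R e + (2 * c2 * (N \<bullet> h)) *\<^sub>R N - (2 * c3) *\<^sub>R h)"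
  have "linear (\<lambda>h. (2 * c1 * (e \<bullet> h)) *\<^sub>R e + (2 * c2 * (N \<bullet> h)) *\<^sub>R N - (2 * c3) *\<^sub>R h)"
    by (rule linearI) (simp_all add: inner_add_right algebra_simps)
  then have H: "H *v h = (2 * c1 * (e \<bullet> h)) *\<^sub>R e + (2 * c2 * (N \<bullet> h)) *\<^sub>R N - (2 * c3) *\<^sub>R h" for h
    unfolding H_def by (simp add: matrix_vector_mul)
  have "pucci_min lam Lam H \<le> f x0"
    by (rule vs[unfolded visc_super_def, rule_format, OF x0, where \<delta>=\<delta> and
            \<phi>="\<lambda>y. u x0 + p \<bullet> (y - x0) + c1 * (e \<bullet> (y - x0))\<^sup>2 + c2 * (N \<bullet> (y - x0))\<^sup>2 - c3 * ((y - x0) \<bullet> (y - x0))"])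
       (use C2_hessian_quadratic[OF H, of "u x0" p x0 \<delta>] \<delta> touch in \<open>intro conjI ballI, auto\<close>)
  moreover have "lam * (2 * c1 * (norm e)\<^sup>2 + 2 * c2 * (norm N)\<^sup>2) - Lam * real CARD('n) * (2 * c3) \<le> pucci_min lam Lam H"
    by (rule pucci_min_lower_bound[OF lam]) (use c H in auto)
  ultimately show ?thesis by (simp add: algebra_simps)
qed

section \<open>Contact with supporting planes\<close>

lemma lsc_on_subset: "lsc_on S f \<Longrightarrow> T \<subseteq> S \<Longrightarrow> lsc_on T f"
  unfolding lsc_on_def by (meson subsetD)

lemma lsc_on_add_continuous:
  assumes f: "lsc_on S f" and g: "continuous_on S g"
  shows "lsc_on S (\<lambda>x. f x + g x)"
  unfolding lsc_on_def
proof (intro ballI allI impI)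
  fix x t assume x: "x \<in> S" and t: "t < f x + g x"
  define d where "d = (f x + g x - t) / 2"
  have d: "d > 0" using t by (simp add: d_def)
  have "f x - d < f x" using d by simp
  then obtain e1 where e1: "e1 > 0" "\<forall>y\<in>S. dist y x < e1 \<longrightarrow> f x - d < f y"
    using f x unfolding lsc_on_def by blast
  obtain e2 where e2: "e2 > 0" "\<forall>y\<in>S. dist y x < e2 \<longrightarrow> dist (g y) (g x) < d"
    using g x d unfolding continuous_on_iff by blast
  have "t < f y + g y" if y: "y \<in> S" "dist y x < min e1 e2" for y
  proof -
    have "f x - d < f y" "dist (g y) (g x) < d" using e1 e2 y by auto
    then have "f x + g x - 2 * d < f y + g y" by (auto simp: dist_real_def abs_less_iff)
    moreover have "f x + g x - 2 * d = t" unfolding d_def by (simp add: field_simps)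
    ultimately show ?thesis by simp
  qed
  then show "\<exists>e>0. \<forall>y\<in>S. dist y x < e \<longrightarrow> t < f y + g y"
    using e1(1) e2(1) by (intro exI[of _ "min e1 e2"]) auto
qed

text \<open>Without a minimiser each \<open>x\<close> has a better point \<open>w x\<close>, and
  \<open>f\<close> exceeds \<open>f (w x)\<close> near \<open>x\<close>. In a finite subcover take
  the centre \<open>c\<close> with the lowest \<open>f (w c)\<close>: the point \<open>w c\<close>
  lies in one of the balls, which contradicts that choice.\<close>

lemma lsc_on_attains_inf:
  assumes S: "compact S" "S \<noteq> {}" and f: "lsc_on S f"
  shows "\<exists>x\<in>S. \<forall>y\<in>S. f x \<le> f y"
proof (rule ccontr)
  assume "\<not> ?thesis"
  then have "\<forall>x\<in>S. \<exists>y\<in>S. f y < f x" by (auto simp: not_le)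
  then obtain w where w: "\<And>x. x \<in> S \<Longrightarrow> w x \<in> S \<and> f (w x) < f x" by metis
  have "\<forall>x\<in>S. \<exists>e>0. \<forall>y\<in>S. dist y x < e \<longrightarrow> f (w x) < f y"
    using f w unfolding lsc_on_def by blast
  then obtain e where e: "\<And>x. x \<in> S \<Longrightarrow> e x > 0 \<and> (\<forall>y\<in>S. dist y x < e x \<longrightarrow> f (w x) < f y)"
    by metis
  have "S \<subseteq> (\<Union>x\<in>S. ball x (e x))" using e by force
  with S(1) obtain C where C: "C \<subseteq> S" "finite C" "S \<subseteq> (\<Union>x\<in>C. ball x (e x))"
    using compactE_image[of S S "\<lambda>x. ball x (e x)"] by auto
  have "C \<noteq> {}" using C(3) S(2) by auto
  obtain c where c: "c \<in> C" "\<And>x. x \<in> C \<Longrightarrow> f (w c) \<le> f (w x)"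
    using C(2) \<open>C \<noteq> {}\<close> arg_min_if_finite(1)[of C "\<lambda>x. f (w x)"] arg_min_least[of C _ "\<lambda>x. f (w x)"] by blast
  have "w c \<in> S" using w c(1) C(1) by blast
  then obtain c' where c': "c' \<in> C" "w c \<in> ball c' (e c')" using C(3) by blast
  have "dist (w c) c' < e c'" using c'(2) by (simp add: dist_commute)
  then have "f (w c') < f (w c)" using e[of c'] C(1) c'(1) \<open>w c \<in> S\<close> by blast
  then show False using c(2)[OF c'(1)] by simp
qed

text \<open>The plane lies below \<open>v\<close> on the whole closed ball and may touch on its
  boundary. Every slope then has a contact point by mere minimisation; touching on the sphere is
  excluded separately, for small slopes.\<close>

definition contact :: "('a::real_inner \<Rightarrow> real) \<Rightarrow> 'a \<Rightarrow> 'a \<Rightarrow> bool" where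
  "contact v x p \<longleftrightarrow> x \<in> cball 0 1 \<and> (\<forall>y\<in>cball 0 1. v x + p \<bullet> (y - x) \<le> v y)"

text \<open>A projection of the closed bounded set of pairs of contact point and slope. Lower
  semicontinuity is enough, because the value at the moving contact point stands on the smaller side
  of the inequality. Compactness later keeps the contact points at a positive distance from the
  interface and the sphere.\<close>

lemma compact_contact_points:
  fixes v :: "'a::euclidean_space \<Rightarrow> real"
  assumes v: "lsc_on (cball 0 1) v"
  shows "compact {x. \<exists>p\<in>cball 0 R. contact v x p}"
proof -
  define T where "T = {z \<in> cball 0 1 \<times> cball 0 R. contact v (fst z) (snd z)}"
  have "closed T" unfolding closed_sequential_limits
  proof (intro allI impI, elim conjE)
    fix s l assume s: "\<forall>n. s n \<in> T" and lim: "s \<longlonglongrightarrow> l"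
    have l: "l \<in> cball 0 1 \<times> cball 0 R"
      using closed_sequentially[of "cball 0 1 \<times> cball 0 R" s l] s lim by (auto simp: T_def closed_Times)
    have l1: "(\<lambda>n. fst (s n)) \<longlonglongrightarrow> fst l" and l2: "(\<lambda>n. snd (s n)) \<longlonglongrightarrow> snd l"
      using lim by (auto intro: tendsto_fst tendsto_snd)
    have "v (fst l) + snd l \<bullet> (y - fst l) \<le> v y" if y: "y \<in> cball 0 1" for y
    proof (rule field_le_epsilon)
      fix d :: real assume d: "d > 0"
      have "v (fst l) - d < v (fst l)" using d by simp
      then obtain e where e: "e > 0" "\<forall>z\<in>cball 0 1. dist z (fst l) < e \<longrightarrow> v (fst l) - d < v z"
        using v l unfolding lsc_on_def by (metis mem_Times_iff)
      have "\<forall>\<^sub>F n in sequentially. dist (fst (s n)) (fst l) < e"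
        using l1 e(1) by (rule tendstoD)
      moreover have "fst (s n) \<in> cball 0 1" and "contact v (fst (s n)) (snd (s n))" for n
        using s[rule_format, of n] by (auto simp: T_def contact_def)
      then have "v (fst (s n)) + snd (s n) \<bullet> (y - fst (s n)) \<le> v y"
          and "dist (fst (s n)) (fst l) < e \<Longrightarrow> v (fst l) - d < v (fst (s n))" for n
        using y e(2) by (auto simp: contact_def)
      ultimately have "\<forall>\<^sub>F n in sequentially. v (fst l) - d + snd (s n) \<bullet> (y - fst (s n)) \<le> v y"
        by (elim eventually_mono) (smt (verit))
      moreover have "(\<lambda>n. v (fst l) - d + snd (s n) \<bullet> (y - fst (s n))) \<longlonglongrightarrow> v (fst l) - d + snd l \<bullet> (y - fst l)"
        by (intro tendsto_intros l1 l2)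
      ultimately have "v (fst l) - d + snd l \<bullet> (y - fst l) \<le> v y"
        by (intro tendsto_upperbound[of _ _ sequentially]) auto
      then show "v (fst l) + snd l \<bullet> (y - fst l) \<le> v y + d" by simp
    qed
    then show "l \<in> T" using l by (auto simp: T_def contact_def)
  qed
  moreover have "bounded T"
    by (rule bounded_subset[OF bounded_Times[OF bounded_cball bounded_cball]]) (auto simp: T_def)
  ultimately have "compact (fst ` T)"
    by (intro compact_continuous_image continuous_intros) (simp add: compact_eq_bounded_closed)
  moreover have "fst ` T = {x. \<exists>p\<in>cball 0 R. contact v x p}"
    by (force simp: T_def contact_def image_iff)
  ultimately show ?thesis by simp
qed

text \<open>The barrier is \<open>(a / 9r) ((h + r)\<^sup>2 - \<kappa> |y - x0|\<^sup>2)\<close> on the slab \<open>-r \<le> h \<le> 2r\<close>, where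
  \<open>a = |p1 - p0|\<close> and \<open>h\<close> is the coordinate along \<open>p1 - p0\<close> centred at \<open>x0\<close>: the second
  contact plane lifts \<open>v\<close> above it at \<open>h = 2r\<close>.\<close>

lemma contact_slope_lipschitz:
  fixes v F :: "'a::euclidean_space \<Rightarrow> real"
  assumes v: "lsc_on (cball 0 1) v" and lam: "0 < lam" and kap: "0 < kap" and r: "0 < r" and \<Phi>: "0 \<le> \<Phi>"
    and \<Omega>: "\<Omega> \<subseteq> ball 0 1"
    and Q: "\<And>z p e A \<delta>. z \<in> \<Omega> \<Longrightarrow> A > 0 \<Longrightarrow> norm e = 1 \<Longrightarrow> \<delta> > 0 \<Longrightarrow>
        (\<And>y. y \<in> ball z \<delta> \<Longrightarrow> v z + p \<bullet> (y - z) + A * ((e \<bullet> (y - z))\<^sup>2 - kap * ((y - z) \<bullet> (y - z))) \<le> v y)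
        \<Longrightarrow> A * lam \<le> F z"
    and c: "contact v x0 p0" "contact v x1 p1" "dist x0 x1 \<le> r"
    and sub: "cball x0 (3 * r / sqrt kap) \<subseteq> \<Omega>" and F: "\<And>y. y \<in> cball x0 (3 * r / sqrt kap) \<Longrightarrow> F y \<le> \<Phi>"
  shows "norm (p1 - p0) \<le> 9 * r * \<Phi> / lam"
proof (cases "p1 = p0")
  case True
  then show ?thesis using lam r \<Phi> by simp
next
  case False
  define a where "a = norm (p1 - p0)"
  define e where "e = (p1 - p0) /\<^sub>R a"
  define h where "h y = e \<bullet> (y - x0)" for y
  \<comment> \<open>On the slab \<open>(h y + r)\<^sup>2\<close> is at most
    \<open>9 * r\<^sup>2 = kap * \<rho>\<^sup>2\<close>, so the barrier is nonpositive at distance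
    \<open>\<rho>\<close> from \<open>x0\<close>.\<close>
  define \<rho> where "\<rho> = 3 * r / sqrt kap"
  \<comment> \<open>At \<open>h = 2 * r\<close> the barrier is then at most
    \<open>9 * A * r\<^sup>2 = a * r\<close>, while the second plane exceeds the first there by at
    least \<open>a * (2 * r - h x1)\<close>, which is no less than \<open>a * r\<close>.\<close>
  define A where "A = a / (9 * r)"
  define b where "b y = A * ((h y + r)\<^sup>2 - kap * ((y - x0) \<bullet> (y - x0)))" for y
  have a: "a > 0" using False by (simp add: a_def)
  have A: "A > 0" using a r by (simp add: A_def)
  have e1: "norm e = 1" using a by (simp add: e_def a_def)
  have pe: "p1 = p0 + a *\<^sub>R e" using a by (simp add: e_def)
  have \<rho>: "\<rho> > 0" using r kap by (simp add: \<rho>_def)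
  have \<rho>2: "kap * \<rho>\<^sup>2 = 9 * r\<^sup>2" using kap by (simp add: \<rho>_def power_divide power_mult_distrib)
  have hc: "continuous_on T h" for T unfolding h_def by (intro continuous_intros)
  have bc: "continuous_on T b" for T unfolding b_def
    by (intro continuous_intros hc)
  define S where "S = cball x0 \<rho> \<inter> {y. -r \<le> h y \<and> h y \<le> 2 * r}"
  have "closed {y. -r \<le> h y \<and> h y \<le> 2 * r}"
    by (intro closed_Collect_conj closed_Collect_le hc continuous_on_const)
  then have "compact S" unfolding S_def by (intro compact_Int_closed) auto
  have x0S: "x0 \<in> S" using r \<rho> by (simp add: S_def h_def)
  have S\<Omega>: "S \<subseteq> \<Omega>" using sub by (auto simp: S_def \<rho>_def)
  have Sc: "S \<subseteq> cball 0 1" using S\<Omega> \<Omega> ball_subset_cball by blast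
  define g where "g y = v y + (- v x0 - p0 \<bullet> (y - x0) - b y)" for y
  have "lsc_on S g" unfolding g_def
    by (intro lsc_on_add_continuous lsc_on_subset[OF v Sc] continuous_intros bc)
  from lsc_on_attains_inf[OF \<open>compact S\<close> _ this] x0S
  obtain z where z: "z \<in> S" "\<And>y. y \<in> S \<Longrightarrow> g z \<le> g y" by blast
  have "g z \<le> g x0" using z x0S by blast
  also have "g x0 = - (A * r\<^sup>2)" by (simp add: g_def b_def h_def)
  also have "\<dots> < 0" using A r by simp
  finally have gz: "g z < 0" .
  have zc: "z \<in> cball 0 1" using z Sc by blast
  have lo0: "v z \<ge> v x0 + p0 \<bullet> (z - x0)" using c(1) zc by (simp add: contact_def)
  have "v x1 \<ge> v x0 + p0 \<bullet> (x1 - x0)" using c by (simp add: contact_def)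
  moreover have "v z \<ge> v x1 + p1 \<bullet> (z - x1)" using c(2) zc by (simp add: contact_def)
  ultimately have "v z \<ge> v x0 + p0 \<bullet> (z - x0) + a * (e \<bullet> (z - x1))"
    by (simp add: pe inner_add_left inner_diff_right right_diff_distrib)
  moreover have "e \<bullet> (z - x1) = h z - h x1" by (simp add: h_def inner_diff_right)
  moreover have "h x1 \<le> r"
  proof -
    have "h x1 \<le> norm e * norm (x1 - x0)" unfolding h_def by (rule norm_cauchy_schwarz)
    also have "\<dots> \<le> r" using c(3) e1 by (simp add: dist_norm norm_minus_commute)
    finally show ?thesis .
  qed
  then have "a * (h z - r) \<le> a * (h z - h x1)" using a by (intro mult_left_mono) auto
  ultimately have lo1: "v z \<ge> v x0 + p0 \<bullet> (z - x0) + a * (h z - r)" by simp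
  have b_pos: "b z > 0" using gz lo0 by (simp add: g_def)
  have hz: "-r \<le> h z" "h z \<le> 2 * r" and dz: "dist x0 z \<le> \<rho>" using z(1) by (auto simp: S_def)
  \<comment> \<open>The minimiser \<open>z\<close> is kept off the three pieces of the boundary of
    \<open>S\<close>: the barrier is nonpositive at \<open>h = -r\<close> and at distance
    \<open>\<rho>\<close>, although \<open>b z > 0\<close>, and at \<open>h = 2 * r\<close> the
    second plane is too high.\<close>
  have "-r \<noteq> h z"
  proof
    assume eq: "-r = h z"
    have "b z \<le> 0" unfolding b_def eq[symmetric] using A kap by (intro mult_nonneg_nonpos) auto
    then show False using b_pos by simp
  qed
  moreover have "h z \<noteq> 2 * r"
  proof
    assume eq: "h z = 2 * r"
    have "b z \<le> A * (9 * r\<^sup>2)" unfolding b_def eq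
      using A kap by (intro mult_left_mono) (auto simp: power2_eq_square)
    also have "\<dots> = a * r" using r by (simp add: A_def power2_eq_square)
    finally show False using gz lo1 eq by (simp add: g_def)
  qed
  moreover have "dist x0 z \<noteq> \<rho>"
  proof
    assume eq: "dist x0 z = \<rho>"
    have "(z - x0) \<bullet> (z - x0) = \<rho>\<^sup>2" using eq by (simp add: dist_norm norm_minus_commute dot_square_norm)
    moreover have "(h z + r)\<^sup>2 \<le> (3 * r)\<^sup>2" using hz by (intro power_mono) auto
    ultimately have "b z \<le> 0" unfolding b_def using A \<rho>2
      by (intro mult_nonneg_nonpos) (auto simp: power2_eq_square)
    then show False using b_pos by simp
  qed
  ultimately have "z \<in> ball x0 \<rho> \<inter> {y. -r < h y \<and> h y < 2 * r}" using hz dz by simp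
  moreover have "open (ball x0 \<rho> \<inter> {y. -r < h y \<and> h y < 2 * r})"
    by (intro open_Int open_ball open_Collect_conj open_Collect_less hc continuous_on_const)
  ultimately have "\<exists>\<delta>>0. ball z \<delta> \<subseteq> ball x0 \<rho> \<inter> {y. -r < h y \<and> h y < 2 * r}"
    by (simp only: open_contains_ball)
  then obtain \<delta> where \<delta>: "\<delta> > 0" "ball z \<delta> \<subseteq> ball x0 \<rho> \<inter> {y. -r < h y \<and> h y < 2 * r}"
    by blast
  \<comment> \<open>\<open>p0\<close> plus the gradient of the barrier at \<open>z\<close>;
    expanding the quadratic barrier around \<open>z\<close> is exact, so its second-order part is
    the one demanded by \<open>Q\<close>.\<close>
  define p where "p = p0 + (2 * A * (h z + r)) *\<^sub>R e - (2 * A * kap) *\<^sub>R (z - x0)"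
  have "A * lam \<le> F z"
  proof (rule Q)
    fix y assume "y \<in> ball z \<delta>"
    then have "y \<in> S" using \<delta>(2) by (force simp: S_def)
    from z(2)[OF this] have ge: "v z - p0 \<bullet> (z - x0) - b z \<le> v y - p0 \<bullet> (y - x0) - b y" by (simp add: g_def)
    define w where "w = y - z"
    define q where "q = z - x0"
    have yx: "y - x0 = q + w" by (simp add: w_def q_def)
    have hy: "h y = h z + e \<bullet> w" by (simp add: h_def w_def inner_diff_right)
    have "b y - b z = 2 * A * (h z + r) * (e \<bullet> w) - 2 * A * kap * (q \<bullet> w) + A * ((e \<bullet> w)\<^sup>2 - kap * (w \<bullet> w))"
      unfolding b_def hy yx q_def[symmetric]
      by (simp add: inner_add_left inner_add_right inner_commute[of w q] power2_eq_square algebra_simps)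
    moreover have "p \<bullet> w = p0 \<bullet> w + 2 * A * (h z + r) * (e \<bullet> w) - 2 * A * kap * (q \<bullet> w)"
      by (simp add: p_def q_def inner_add_left inner_diff_left)
    moreover have "p0 \<bullet> (y - x0) = p0 \<bullet> (z - x0) + p0 \<bullet> w" by (simp add: w_def inner_diff_right)
    ultimately show "v z + p \<bullet> (y - z) + A * ((e \<bullet> (y - z))\<^sup>2 - kap * ((y - z) \<bullet> (y - z))) \<le> v y"
      using ge unfolding w_def[symmetric] by linarith
  qed (use z(1) S\<Omega> A e1 \<delta> in auto)
  also have "F z \<le> \<Phi>" using z(1) by (intro F) (auto simp: S_def \<rho>_def)
  finally have "a * lam \<le> 9 * r * \<Phi>" using r by (simp add: A_def field_simps)
  then show ?thesis using lam by (simp add: a_def[symmetric] field_simps)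
qed

section \<open>Volume of the slopes and a cubical grid\<close>

lemma sum_ball_content_ge:
  fixes p :: "'i \<Rightarrow> 'a::euclidean_space"
  assumes R: "0 \<le> R" and I: "finite I" and q: "\<And>i. i \<in> I \<Longrightarrow> 0 \<le> q i"
    and cover: "cball (0::'a) R \<subseteq> (\<Union>i\<in>I. cball (p i) (q i))"
  shows "R ^ DIM('a) \<le> (\<Sum>i\<in>I. q i ^ DIM('a))"
proof -
  define U where "U = unit_ball_vol (real DIM('a))"
  have U: "U > 0" by (simp add: U_def)
  have "U * R ^ DIM('a) = measure lborel (cball (0::'a) R)"
    using content_cball[OF R, of "0::'a"] by (simp add: U_def)
  also have "\<dots> \<le> measure lborel (\<Union>i\<in>I. cball (p i) (q i))"
    using cover I by (intro measure_mono_fmeasurable fmeasurable_compact compact_UN compact_cball) auto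
  also have "\<dots> \<le> (\<Sum>i\<in>I. measure lborel (cball (p i) (q i)))"
    by (rule measure_UNION_le[OF I]) simp
  also have "\<dots> = (\<Sum>i\<in>I. U * q i ^ DIM('a))"
    using q by (intro sum.cong refl) (simp add: content_cball U_def)
  also have "\<dots> = U * (\<Sum>i\<in>I. q i ^ DIM('a))" by (simp add: sum_distrib_left)
  finally show ?thesis using U by simp
qed

definition grid_cell :: "real \<Rightarrow> real^'n::finite \<Rightarrow> 'n \<Rightarrow> int" where
  "grid_cell \<rho> x = (\<lambda>i. \<lfloor>x $ i / \<rho>\<rfloor>)"

lemma finite_grid_cells:
  fixes K :: "(real^'n::finite) set"
  assumes "bounded K"
  shows "finite (grid_cell \<rho> ` K)"
proof -
  obtain B where B: "\<And>x. x \<in> K \<Longrightarrow> norm x \<le> B" using assms by (auto simp: bounded_iff)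
  have "grid_cell \<rho> x \<in> PiE UNIV (\<lambda>_. {-\<lceil>B / \<bar>\<rho>\<bar>\<rceil> .. \<lceil>B / \<bar>\<rho>\<bar>\<rceil>})" if "x \<in> K" for x
  proof -
    have "\<lfloor>x $ i / \<rho>\<rfloor> \<in> {-\<lceil>B / \<bar>\<rho>\<bar>\<rceil> .. \<lceil>B / \<bar>\<rho>\<bar>\<rceil>}" for i
    proof -
      have "\<bar>x $ i\<bar> \<le> B" using B[OF that] component_le_norm_cart[of x i] by linarith
      then have "\<bar>x $ i / \<rho>\<bar> \<le> B / \<bar>\<rho>\<bar>" by (simp add: divide_right_mono)
      then have "x $ i / \<rho> \<le> B / \<bar>\<rho>\<bar>" "- (B / \<bar>\<rho>\<bar>) \<le> x $ i / \<rho>" by linarith+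
      moreover have "B / \<bar>\<rho>\<bar> \<le> \<lceil>B / \<bar>\<rho>\<bar>\<rceil>" by simp
      ultimately have "real_of_int (- \<lceil>B / \<bar>\<rho>\<bar>\<rceil>) \<le> x $ i / \<rho>" "x $ i / \<rho> \<le> real_of_int \<lceil>B / \<bar>\<rho>\<bar>\<rceil>" by linarith+
      then show ?thesis by (simp add: le_floor_iff floor_le_iff)
    qed
    then show ?thesis by (auto simp: grid_cell_def)
  qed
  then have "grid_cell \<rho> ` K \<subseteq> PiE UNIV (\<lambda>_. {-\<lceil>B / \<bar>\<rho>\<bar>\<rceil> .. \<lceil>B / \<bar>\<rho>\<bar>\<rceil>})" by blast
  then show ?thesis by (rule finite_subset) (intro finite_PiE, auto)
qed

text \<open>Bounding the norm by the sum of the coordinates costs a factor \<open>CARD('n)\<close>;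
  it reappears in the constant \<open>9 * real CARD('n) / lam\<close> of the measure
  estimate.\<close>

lemma dist_grid_cell_le:
  fixes x y :: "real^'n::finite"
  assumes \<rho>: "\<rho> > 0" and eq: "grid_cell \<rho> x = grid_cell \<rho> y"
  shows "dist x y \<le> real CARD('n) * \<rho>"
proof -
  have "\<bar>(x - y) $ i\<bar> \<le> \<rho>" for i
  proof -
    have "\<lfloor>x $ i / \<rho>\<rfloor> = \<lfloor>y $ i / \<rho>\<rfloor>" using eq by (auto simp: grid_cell_def fun_eq_iff)
    then have "\<bar>x $ i / \<rho> - y $ i / \<rho>\<bar> \<le> 1" by linarith
    then have "\<bar>(x $ i - y $ i) / \<rho>\<bar> \<le> 1" by (simp add: diff_divide_distrib)
    then show ?thesis using \<rho> by (simp add: abs_divide)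
  qed
  then have "(\<Sum>i\<in>UNIV. \<bar>(x - y) $ i\<bar>) \<le> (\<Sum>i\<in>(UNIV::'n set). \<rho>)" by (intro sum_mono)
  then show ?thesis using norm_le_l1_cart[of "x - y"] by (simp add: dist_norm)
qed

text \<open>The open interior of the cell \<open>c\<close>. These boxes are pairwise disjoint and
  carry the full volume of the cells, which suffices to compare a sum over cells with an
  integral.\<close>

definition grid_box :: "real \<Rightarrow> ('n::finite \<Rightarrow> int) \<Rightarrow> (real^'n) set" where
  "grid_box \<rho> c = box (\<chi> i. \<rho> * c i) ((\<chi> i. \<rho> * c i) + \<rho> *\<^sub>R One)"

lemma grid_cell_of_grid_box:
  fixes x :: "real^'n::finite"
  assumes \<rho>: "\<rho> > 0" and x: "x \<in> grid_box \<rho> c"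
  shows "grid_cell \<rho> x = c"
proof
  fix i
  have One: "(One :: real^'n) $ i = 1" for i using inner_sum_left_Basis[of "axis i (1::real)" "\<lambda>_. 1"] by (simp add: inner_axis)
  have "\<rho> * c i < x $ i" "x $ i < \<rho> * c i + \<rho>"
    using x One[of i] by (auto simp: grid_box_def mem_box_cart dest!: spec[of _ i])
  then have "real_of_int (c i) \<le> x $ i / \<rho>" "x $ i / \<rho> < real_of_int (c i) + 1"
    using \<rho> by (auto simp: field_simps)
  then show "grid_cell \<rho> x i = c i" unfolding grid_cell_def by (simp add: floor_unique)
qed

lemma measure_grid_box:
  assumes \<rho>: "\<rho> > 0"
  shows "measure lborel (grid_box \<rho> c :: (real^'n::finite) set) = \<rho> ^ CARD('n)"
proof -
  have "measure lborel (box a (a + \<rho> *\<^sub>R One)) = \<rho> ^ CARD('n)" for a :: "real^'n"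
    using \<rho> by (subst measure_lborel_box_eq) (simp add: inner_add_left inner_sum_left_Basis)
  then show ?thesis by (simp add: grid_box_def)
qed

text \<open>Covers the slopes by one ball per cell of a fine grid, with radius controlled by
  \<open>contact_slope_lipschitz\<close>; this replaces the area formula for the normal map.\<close>

lemma contact_measure_estimate:
  fixes v F :: "real^'n::finite \<Rightarrow> real"
  assumes v: "lsc_on (cball 0 1) v" and lam: "0 < lam" and kap: "0 < kap" "kap \<le> 1"
    and \<Omega>: "open \<Omega>" "\<Omega> \<subseteq> ball 0 1"
    and F: "continuous_on \<Omega> F" "\<And>x. x \<in> \<Omega> \<Longrightarrow> 0 \<le> F x" and eps: "\<epsilon> > 0"
    and int: "set_integrable lborel \<Omega> (\<lambda>x. (F x + 2 * \<epsilon>) ^ CARD('n))"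
    and Q: "\<And>z p e A \<delta>. z \<in> \<Omega> \<Longrightarrow> A > 0 \<Longrightarrow> norm e = 1 \<Longrightarrow> \<delta> > 0 \<Longrightarrow>
        (\<And>y. y \<in> ball z \<delta> \<Longrightarrow> v z + p \<bullet> (y - z) + A * ((e \<bullet> (y - z))\<^sup>2 - kap * ((y - z) \<bullet> (y - z))) \<le> v y)
        \<Longrightarrow> A * lam \<le> F z"
    and R: "0 \<le> R"
    and ex: "\<And>p. p \<in> cball 0 R \<Longrightarrow> \<exists>x. contact v x p"
    and inside: "\<And>x p. p \<in> cball 0 R \<Longrightarrow> contact v x p \<Longrightarrow> x \<in> \<Omega>"
  shows "R ^ CARD('n) \<le> (9 * real CARD('n) / lam) ^ CARD('n) * (LINT x:\<Omega>|lborel. (F x + 2 * \<epsilon>) ^ CARD('n))"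
proof -
  define n where "n = real CARD('n)"
  have n: "n > 0" by (simp add: n_def)
  define K where "K = {x. \<exists>p\<in>cball 0 R. contact v x p}"
  have K: "compact K" unfolding K_def by (rule compact_contact_points[OF v])
  have K\<Omega>: "K \<subseteq> \<Omega>" using inside by (auto simp: K_def)
  obtain d where d: "d > 0" "(\<Union>x\<in>K. ball x d) \<subseteq> \<Omega>"
    using compact_subset_open_imp_ball_epsilon_subset[OF K \<Omega>(1) K\<Omega>] by blast
  \<comment> \<open>A compact neighbourhood of the contact set inside \<open>\<Omega>\<close>:
    \<open>F\<close> must be uniformly continuous also at the points near \<open>K\<close> that the
    barriers reach.\<close>
  define K' where "K' = {x + y |x y. x \<in> K \<and> y \<in> cball 0 (d/2)}"
  have K'I: "y \<in> K'" if "x \<in> K" "dist x y \<le> d / 2" for x y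
    unfolding K'_def mem_Collect_eq using that
    by (intro exI[of _ x] exI[of _ "y - x"]) (auto simp: dist_norm norm_minus_commute)
  have "compact K'" unfolding K'_def by (intro compact_sums K compact_cball)
  have "K' \<subseteq> \<Omega>"
  proof
    fix z assume "z \<in> K'"
    then obtain x y where z: "z = x + y" "x \<in> K" "norm y \<le> d / 2" by (auto simp: K'_def)
    then have "z \<in> ball x d" using d(1) by (simp add: dist_norm)
    then show "z \<in> \<Omega>" using d(2) z(2) by blast
  qed
  then have "uniformly_continuous_on K' F"
    using compact_uniformly_continuous[OF continuous_on_subset[OF F(1)] \<open>compact K'\<close>] by blast
  then obtain \<eta> where \<eta>: "\<eta> > 0" "\<And>x y. x \<in> K' \<Longrightarrow> y \<in> K' \<Longrightarrow> dist y x < \<eta> \<Longrightarrow> dist (F y) (F x) < \<epsilon>"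
    using eps unfolding uniformly_continuous_on_def by metis
  define m where "m = min (d / 2) (\<eta> / 2)"
  have m: "m > 0" "m \<le> d / 2" "m < \<eta>" using d \<eta> by (auto simp: m_def)
  \<comment> \<open>Makes \<open>3 * r / sqrt kap = m\<close>, so the ball carrying the barrier of
    \<open>contact_slope_lipschitz\<close> stays where \<open>F\<close> differs by at most
    \<open>\<epsilon>\<close> from its value at the centre.\<close>
  define \<rho> where "\<rho> = m * sqrt kap / (3 * n)"
  define r where "r = n * \<rho>"
  have \<rho>: "\<rho> > 0" using m kap n by (simp add: \<rho>_def)
  have r: "r > 0" using \<rho> n by (simp add: r_def)
  have rm: "3 * r / sqrt kap = m" using n kap by (simp add: r_def \<rho>_def)
  have "sqrt kap \<le> 1" using kap by simp
  then have "sqrt kap \<le> 3" by linarith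
  then have "r \<le> m" using m n by (simp add: r_def \<rho>_def)
  have near: "y \<in> \<Omega> \<and> \<bar>F y - F x\<bar> \<le> \<epsilon>" if "x \<in> K" "dist x y \<le> m" for x y
  proof -
    have "x \<in> K'" "y \<in> K'" using K'I[OF that(1)] that m d(1) by auto
    then show ?thesis using \<eta>(2)[of x y] that m \<open>K' \<subseteq> \<Omega>\<close> by (auto simp: dist_commute dist_real_def)
  qed
  define I where "I = grid_cell \<rho> ` K"
  have I: "finite I" unfolding I_def by (intro finite_grid_cells compact_imp_bounded K)
  have "\<forall>c\<in>I. \<exists>x p. x \<in> K \<and> contact v x p \<and> grid_cell \<rho> x = c" by (auto simp: I_def K_def)
  then obtain X P where XP: "\<And>c. c \<in> I \<Longrightarrow> X c \<in> K \<and> contact v (X c) (P c) \<and> grid_cell \<rho> (X c) = c"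
    by metis
  \<comment> \<open>This \<open>\<epsilon>\<close> makes \<open>\<Phi> c\<close> a bound for
    \<open>F\<close> on the whole ball around \<open>X c\<close>. Comparing \<open>F (X c)\<close>
    with \<open>F x\<close> on the cell costs another one, whence \<open>2 * \<epsilon>\<close> in
    the integral.\<close>
  define \<Phi> where "\<Phi> c = F (X c) + \<epsilon>" for c
  have \<Phi>: "\<Phi> c \<ge> 0" if "c \<in> I" for c using F(2)[of "X c"] XP[OF that] K\<Omega> eps by (auto simp: \<Phi>_def)
  have "cball 0 R \<subseteq> (\<Union>c\<in>I. cball (P c) (9 * r * \<Phi> c / lam))"
  proof
    fix p :: "real^'n" assume p: "p \<in> cball 0 R"
    obtain x where x: "contact v x p" using ex[OF p] by blast
    then have xK: "x \<in> K" using p by (auto simp: K_def)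
    define c where "c = grid_cell \<rho> x"
    have cI: "c \<in> I" using xK by (simp add: c_def I_def)
    note Xc = XP[OF cI]
    have "norm (p - P c) \<le> 9 * r * \<Phi> c / lam"
    proof (rule contact_slope_lipschitz[OF v lam kap(1) r \<Phi>[OF cI] \<Omega>(2) Q])
      show "contact v (X c) (P c)" "contact v x p" using Xc x by auto
      show "dist (X c) x \<le> r" using dist_grid_cell_le[OF \<rho>, of "X c" x] Xc by (simp add: c_def r_def n_def)
      show "cball (X c) (3 * r / sqrt kap) \<subseteq> \<Omega>" using near Xc by (auto simp: rm)
      show "F y \<le> \<Phi> c" if "y \<in> cball (X c) (3 * r / sqrt kap)" for y
        using near[of "X c" y] Xc that unfolding rm \<Phi>_def by (auto simp: abs_le_iff)
    qed
    then have "p \<in> cball (P c) (9 * r * \<Phi> c / lam)" by (simp add: dist_norm norm_minus_commute)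
    then show "p \<in> (\<Union>c\<in>I. cball (P c) (9 * r * \<Phi> c / lam))" using cI by blast
  qed
  from sum_ball_content_ge[OF R I _ this] have "R ^ CARD('n) \<le> (\<Sum>c\<in>I. (9 * r * \<Phi> c / lam) ^ CARD('n))"
    using \<Phi> r lam by simp
  also have "\<dots> = (\<Sum>c\<in>I. (9 * n / lam) ^ CARD('n) * (\<Phi> c ^ CARD('n) * \<rho> ^ CARD('n)))"
    by (intro sum.cong refl) (simp add: r_def power_mult_distrib power_divide mult_ac)
  also have "\<dots> = (9 * n / lam) ^ CARD('n) * (\<Sum>c\<in>I. \<Phi> c ^ CARD('n) * \<rho> ^ CARD('n))"
    by (simp add: sum_distrib_left)
  also have "(\<Sum>c\<in>I. \<Phi> c ^ CARD('n) * \<rho> ^ CARD('n)) \<le> (LINT x:\<Omega>|lborel. (F x + 2 * \<epsilon>) ^ CARD('n))"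
  proof -
    define s :: "real^'n \<Rightarrow> real" where "s x = (\<Sum>c\<in>I. \<Phi> c ^ CARD('n) * indicator (grid_box \<rho> c) x)" for x
    have fin: "emeasure lborel (grid_box \<rho> c) < \<infinity>" for c :: "'n \<Rightarrow> int"
      unfolding grid_box_def by (rule emeasure_bounded_finite[OF bounded_box])
    have meas: "grid_box \<rho> c \<in> sets lborel" for c :: "'n \<Rightarrow> int"
      by (simp add: grid_box_def)
    have ind: "integrable lborel (indicator (grid_box \<rho> c) :: real^'n \<Rightarrow> real)" for c
      using fin meas by (simp add: integrable_indicator_iff)
    have "(\<Sum>c\<in>I. \<Phi> c ^ CARD('n) * \<rho> ^ CARD('n)) = (LINT x|lborel. s x)"
      unfolding s_def using ind fin by (subst Bochner_Integration.integral_sum) (auto simp: measure_grid_box[OF \<rho>])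
    also have "\<dots> \<le> (LINT x|lborel. indicator \<Omega> x *\<^sub>R (F x + 2 * \<epsilon>) ^ CARD('n))"
    proof (rule integral_mono)
      show "integrable lborel s" unfolding s_def
        by (intro Bochner_Integration.integrable_sum integrable_mult_right ind)
      show "integrable lborel (\<lambda>x. indicator \<Omega> x *\<^sub>R (F x + 2 * \<epsilon>) ^ CARD('n))"
        using int by (simp add: set_integrable_def)
      fix x :: "real^'n"
      show "s x \<le> indicator \<Omega> x *\<^sub>R (F x + 2 * \<epsilon>) ^ CARD('n)"
      proof (cases "\<exists>c\<in>I. x \<in> grid_box \<rho> c")
        case True
        then obtain c where c: "c \<in> I" "x \<in> grid_box \<rho> c" by blast
        have gc: "grid_cell \<rho> x = c" by (rule grid_cell_of_grid_box[OF \<rho> c(2)])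
        have "s x = (\<Sum>c'\<in>I. if c' = c then \<Phi> c ^ CARD('n) else 0)"
          unfolding s_def using c(2) grid_cell_of_grid_box[OF \<rho>] gc
          by (intro sum.cong) (auto simp: indicator_def)
        also have "\<dots> = \<Phi> c ^ CARD('n)" using c(1) I by simp
        finally have sx: "s x = \<Phi> c ^ CARD('n)" .
        note Xc = XP[OF c(1)]
        have "dist (X c) x \<le> r" using dist_grid_cell_le[OF \<rho>, of "X c" x] Xc gc by (simp add: r_def n_def)
        with \<open>r \<le> m\<close> have "x \<in> \<Omega>" "\<bar>F x - F (X c)\<bar> \<le> \<epsilon>" using near[of "X c" x] Xc by auto
        then show ?thesis unfolding sx using \<Phi>[OF c(1)]
          by (auto simp: \<Phi>_def abs_le_iff intro!: power_mono)
      next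
        case False
        then have "s x = 0" unfolding s_def by (intro sum.neutral) auto
        moreover have "0 \<le> indicator \<Omega> x *\<^sub>R (F x + 2 * \<epsilon>) ^ CARD('n)"
          using F(2)[of x] eps by (auto simp: indicator_def)
        ultimately show ?thesis by simp
      qed
    qed
    finally show ?thesis by (simp add: set_lebesgue_integral_def)
  qed
  finally show ?thesis using lam n by (simp add: n_def)
qed

section \<open>Geometry of the interface\<close>

lemma xlast_simps [simp]: "xlast (x - y) = xlast x - xlast y" "xlast (x + y) = xlast x + xlast y"
    "xlast (c *\<^sub>R x) = c * xlast x"
  by (simp_all add: xlast_def)

lemma xprime_simps [simp]: "xprime (x - y) = xprime x - xprime y" "xprime (x + y) = xprime x + xprime y"
    "xprime (c *\<^sub>R x) = c *\<^sub>R xprime x"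
  by (simp_all add: xprime_def vec_eq_iff)

lemma inner_xprime_xlast:
  fixes a b :: "real^('m::finite option)"
  shows "a \<bullet> b = xlast a * xlast b + xprime a \<bullet> xprime b"
  by (simp add: inner_vec_def xlast_def xprime_def UNIV_option_conv sum.reindex)

lemma norm_xprime_xlast:
  fixes a :: "real^('m::finite option)"
  shows "(norm a)\<^sup>2 = (xlast a)\<^sup>2 + (norm (xprime a))\<^sup>2"
  by (simp only: power2_norm_eq_inner inner_xprime_xlast[of a a]) (simp add: power2_eq_square)

lemma norm_xprime_le: "norm (xprime a) \<le> norm a"
  by (rule power2_le_imp_le) (simp_all add: norm_xprime_xlast[of a])

lemma linear_xprime: "linear xprime"
  by (rule linearI) simp_all

lemma linear_xlast: "linear xlast"
  by (rule linearI) simp_all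

lemma xprime_in_cball: "x \<in> cball 0 1 \<Longrightarrow> xprime x \<in> cball 0 1"
  using norm_xprime_le[of x] by simp

section \<open>Tangent paraboloids of real powers\<close>

lemma powr_tangent_quadratic_below:
  fixes h h0 \<beta> :: real
  assumes \<beta>: "0 < \<beta>" "\<beta> < 1" and h: "0 < h" "h \<le> 2 * h0" and h0: "0 < h0"
  shows "h0 powr (1 + \<beta>) + (1 + \<beta>) * h0 powr \<beta> * (h - h0)
      + \<beta> * (1 + \<beta>) / 4 * h0 powr (\<beta> - 1) * (h - h0)\<^sup>2 \<le> h powr (1 + \<beta>)"
proof -
  \<comment> \<open>The second derivative of \<open>t powr (1 + \<beta>)\<close> decreases in
    \<open>t\<close>, and up to \<open>2 * h0\<close> it stays at least half its value at
    \<open>h0\<close>, because \<open>2 powr (\<beta> - 1) \<ge> 1 / 2\<close>. The quarter is this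
    half times the half of a second-order Taylor term.\<close>
  define c where "c = \<beta> * (1 + \<beta>) / 4 * h0 powr (\<beta> - 1)"
  define g where "g t = t powr (1 + \<beta>) - c * (t - h0)\<^sup>2" for t
  define g' where "g' t = (1 + \<beta>) * t powr \<beta> - c * (2 * (t - h0))" for t
  define g'' where "g'' t = (1 + \<beta>) * (\<beta> * t powr (\<beta> - 1)) - c * 2" for t
  have "g' h0 * (h - h0) \<le> g h - g h0"
  proof (rule f''_imp_f'[of "{0<..2 * h0}" g g' g''])
    fix t assume t: "t \<in> {0<..2 * h0}"
    show "DERIV g t :> g' t" unfolding g_def g'_def using t
      by (auto intro!: derivative_eq_intros simp: power2_eq_square)
    show "DERIV g' t :> g'' t" unfolding g'_def g''_def using t
      by (auto intro!: derivative_eq_intros simp: power2_eq_square)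
    have "(1/2) * h0 powr (\<beta> - 1) \<le> 2 powr (\<beta> - 1) * h0 powr (\<beta> - 1)"
      using powr_mono[of "-1" "\<beta> - 1" "2::real"] \<beta> by (intro mult_right_mono) (auto simp: powr_minus)
    also have "\<dots> = (2 * h0) powr (\<beta> - 1)" using h0 by (simp add: powr_mult)
    also have "\<dots> \<le> t powr (\<beta> - 1)" using t \<beta> by (intro powr_mono2') auto
    finally have "\<beta> * (1 + \<beta>) * ((1/2) * h0 powr (\<beta> - 1)) \<le> \<beta> * (1 + \<beta>) * t powr (\<beta> - 1)"
      using \<beta> by (intro mult_left_mono) auto
    then show "0 \<le> g'' t" unfolding g''_def c_def by (simp add: algebra_simps)
  qed (use h h0 in auto)
  then show ?thesis unfolding c_def[symmetric] by (simp add: g_def g'_def)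
qed

text \<open>The tangent line of a concave function, from Young's inequality for
  \<open>t powr q * t0 powr (1 - q)\<close>. The value \<open>t = 0\<close> is included since
  \<open>t\<close> will be the square of a norm that may vanish.\<close>

lemma powr_tangent_above:
  fixes t t0 q :: real
  assumes q: "0 < q" "q < 1" and t: "0 \<le> t" "0 < t0"
  shows "t powr q \<le> t0 powr q + q * t0 powr (q - 1) * (t - t0)"
proof -
  have "t powr q * t0 powr (1 - q) \<le> q * t + (1 - q) * t0"
    using Youngs_inequality_0[of q "1 - q" t t0] q t by (cases "t = 0") auto
  then have "t powr q * t0 powr (1 - q) * t0 powr (q - 1) \<le> (q * t + (1 - q) * t0) * t0 powr (q - 1)"
    by (intro mult_right_mono) auto
  moreover have "t0 powr (1 - q) * t0 powr (q - 1) = 1"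
    using t by (simp add: powr_add[symmetric])
  moreover have "t0 * t0 powr (q - 1) = t0 powr q" using t by (simp add: powr_mult_base)
  ultimately show ?thesis by (simp add: algebra_simps)
qed

text \<open>The power is concave as a function of the squared norm. Its tangent line in that
  variable is an isotropic paraboloid, valid for every \<open>w\<close>.\<close>

lemma norm_powr_above_quadratic:
  fixes z w :: "'a::euclidean_space"
  assumes \<alpha>: "0 < \<alpha>" "\<alpha> < 1" and z: "z \<noteq> 0"
  shows "norm (z + w) powr (1 + \<alpha>) \<le> norm z powr (1 + \<alpha>)
      + (1 + \<alpha>) / 2 * norm z powr (\<alpha> - 1) * (2 * (z \<bullet> w) + w \<bullet> w)"
proof -
  have sq: "((norm x)\<^sup>2) powr r = norm x powr (2 * r)" for x :: 'a and r
    by (simp add: powr_powr[symmetric] powr_numeral del: powr_powr)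
  have "((norm (z + w))\<^sup>2) powr ((1 + \<alpha>) / 2) \<le> ((norm z)\<^sup>2) powr ((1 + \<alpha>) / 2)
      + (1 + \<alpha>) / 2 * ((norm z)\<^sup>2) powr ((1 + \<alpha>) / 2 - 1) * ((norm (z + w))\<^sup>2 - (norm z)\<^sup>2)"
    using \<alpha> z by (intro powr_tangent_above) auto
  moreover have "(norm (z + w))\<^sup>2 - (norm z)\<^sup>2 = 2 * (z \<bullet> w) + w \<bullet> w"
    by (simp add: power2_norm_eq_inner inner_add_left inner_add_right inner_commute)
  ultimately show ?thesis unfolding sq by (simp add: add_divide_distrib diff_divide_distrib)
qed

section \<open>The graph and its normalised height\<close>

locale C1alpha_interface =
  fixes \<alpha> s :: real and \<psi> :: "real^'m::finite \<Rightarrow> real"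
  assumes \<alpha>: "0 < \<alpha>" "\<alpha> < 1"
    and s_nonneg: "0 \<le> s"
    and differentiable: "\<And>y. y \<in> cball 0 1 \<Longrightarrow> \<psi> differentiable (at y within cball 0 1)"
    and grad_holder: "\<And>y z. y \<in> cball 0 1 \<Longrightarrow> z \<in> cball 0 1 \<Longrightarrow>
        norm (grad_within \<psi> (cball 0 1) y - grad_within \<psi> (cball 0 1) z) \<le> s * dist y z powr \<alpha>"
begin

abbreviation "grad \<equiv> grad_within \<psi> (cball 0 1)"

definition "q = sqrt (1 + (norm (grad 0))\<^sup>2)"

text \<open>From \<open>1 + (b + s)\<^sup>2 \<le> (2 + 2 * s\<^sup>2) * (1 + b\<^sup>2)\<close>: the
  gradients at 0 and at any point of the ball differ by at most \<open>s\<close>, so this factor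
  compares their slope factors in both directions, however large the gradients are.\<close>

definition "B = sqrt (2 + 2 * s\<^sup>2)"

text \<open>Dividing by \<open>q\<close> keeps the gradient of \<open>D\<close> between \<open>1 / B\<close> and \<open>B\<close>, however steep the graph is.\<close>

definition D :: "real^('m option) \<Rightarrow> real" where
  "D x = (xlast x - \<psi> (xprime x)) / q"

text \<open>The gradient of \<open>D\<close> at the points over \<open>y\<close>: the upward normal
  of the graph, scaled by the fixed \<open>q\<close> instead of to unit length.\<close>

definition N :: "real^'m \<Rightarrow> real^('m option)" where
  "N y = (\<chi> j. case j of None \<Rightarrow> 1 / q | Some i \<Rightarrow> - (grad y $ i) / q)"

definition graph_pt :: "real^'m \<Rightarrow> real^('m option)" where
  "graph_pt y = (\<chi> j. case j of None \<Rightarrow> \<psi> y | Some i \<Rightarrow> y $ i)"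

lemma q_ge_1: "1 \<le> q" by (simp add: q_def)

lemma q_pos: "0 < q" using q_ge_1 by simp

lemma B_ge_1: "1 \<le> B" by (simp add: B_def)

lemma B_pos: "0 < B" using B_ge_1 by simp

lemma xlast_N [simp]: "xlast (N y) = 1 / q" and xprime_N [simp]: "xprime (N y) = (- 1 / q) *\<^sub>R grad y"
  by (simp_all add: N_def xlast_def xprime_def vec_eq_iff)

lemma xlast_graph_pt [simp]: "xlast (graph_pt y) = \<psi> y" and xprime_graph_pt [simp]: "xprime (graph_pt y) = y"
  by (simp_all add: graph_pt_def xlast_def xprime_def vec_eq_iff)

lemma psi_has_derivative:
  assumes "y \<in> cball 0 1"
  shows "(\<psi> has_derivative (\<lambda>h. grad y \<bullet> h)) (at y within cball 0 1)"
proof -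
  let ?f = "frechet_derivative \<psi> (at y within cball 0 1)"
  have f: "(\<psi> has_derivative ?f) (at y within cball 0 1)"
    using differentiable[OF assms] by (simp add: frechet_derivative_works)
  then have lin: "linear ?f" by (rule has_derivative_linear)
  have "?f h = grad y \<bullet> h" for h
  proof -
    have "?f h = ?f (\<Sum>i\<in>UNIV. h $ i *\<^sub>R axis i 1)"
      using basis_expansion[of h] by (simp add: scalar_mult_eq_scaleR)
    also have "\<dots> = (\<Sum>i\<in>UNIV. h $ i * ?f (axis i 1))"
      by (simp add: linear_sum[OF lin] linear_cmul[OF lin])
    also have "\<dots> = grad y \<bullet> h" by (simp add: inner_vec_def grad_within_def mult.commute)
    finally show ?thesis .
  qed
  then have "?f = (\<lambda>h. grad y \<bullet> h)" by (rule ext)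
  then show ?thesis using f by simp
qed

lemma psi_continuous: "continuous_on (cball 0 1) \<psi>"
  unfolding continuous_on_eq_continuous_within
  by (intro ballI has_derivative_continuous[OF psi_has_derivative])

lemma grad_continuous: "continuous_on (cball 0 1) grad"
  unfolding continuous_on_iff
proof (intro ballI allI impI)
  fix y :: "real^'m" and e :: real assume y: "y \<in> cball 0 1" and e: "0 < e"
  define d where "d = (e / (s + 1)) powr (1 / \<alpha>)"
  have "dist (grad z) (grad y) < e" if z: "z \<in> cball 0 1" "dist z y < d" for z
  proof -
    have "dist z y powr \<alpha> \<le> d powr \<alpha>" using z \<alpha> by (intro powr_mono2) auto
    also have "\<dots> = e / (s + 1)" using \<alpha> e s_nonneg by (simp add: d_def powr_powr)
    finally have "s * dist z y powr \<alpha> \<le> s * (e / (s + 1))" using s_nonneg by (rule mult_left_mono)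
    also have "\<dots> < e" using s_nonneg e by (simp add: field_simps)
    finally show ?thesis using grad_holder[OF z(1) y] by (simp add: dist_norm)
  qed
  moreover have "d > 0" using e s_nonneg by (simp add: d_def)
  ultimately show "\<exists>d>0. \<forall>z\<in>cball 0 1. dist z y < d \<longrightarrow> dist (grad z) (grad y) < e" by blast
qed

lemma psi_taylor:
  assumes y: "y \<in> cball 0 1" and z: "z \<in> cball 0 1"
  shows "\<bar>\<psi> z - \<psi> y - grad y \<bullet> (z - y)\<bar> \<le> s * dist z y powr (1 + \<alpha>)"
proof -
  have seg: "closed_segment y z \<subseteq> cball 0 1"
    using y z by (intro closed_segment_subset convex_cball)
  have "norm ((\<psi> z - grad y \<bullet> z) - (\<psi> y - grad y \<bullet> y)) \<le> (s * dist z y powr \<alpha>) * norm (z - y)"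
  proof (rule differentiable_bound[of "closed_segment y z" "\<lambda>x. \<psi> x - grad y \<bullet> x" "\<lambda>x h. grad x \<bullet> h - grad y \<bullet> h"])
    fix x assume x: "x \<in> closed_segment y z"
    have "(\<psi> has_derivative (\<lambda>h. grad x \<bullet> h)) (at x within closed_segment y z)"
      using psi_has_derivative[of x] x seg by (blast intro: has_derivative_subset)
    then show "((\<lambda>x. \<psi> x - grad y \<bullet> x) has_derivative (\<lambda>h. grad x \<bullet> h - grad y \<bullet> h)) (at x within closed_segment y z)"
      by (intro has_derivative_diff has_derivative_inner_right has_derivative_ident)
    show "onorm (\<lambda>h. grad x \<bullet> h - grad y \<bullet> h) \<le> s * dist z y powr \<alpha>"
    proof (rule onorm_le)
      fix h
      have "norm (grad x \<bullet> h - grad y \<bullet> h) \<le> norm (grad x - grad y) * norm h"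
        by (simp add: inner_diff_left[symmetric] Cauchy_Schwarz_ineq2)
      also have "norm (grad x - grad y) \<le> s * dist x y powr \<alpha>" using x seg y by (intro grad_holder) auto
      also have "s * dist x y powr \<alpha> \<le> s * dist z y powr \<alpha>"
        using s_nonneg \<alpha> x dist_in_closed_segment[OF x]
        by (intro mult_left_mono powr_mono2) (auto simp: dist_commute)
      finally show "norm (grad x \<bullet> h - grad y \<bullet> h) \<le> s * dist z y powr \<alpha> * norm h"
        by (simp add: mult_right_mono)
    qed
  qed auto
  moreover have "dist z y powr \<alpha> * norm (z - y) = dist z y powr (1 + \<alpha>)"
    using \<alpha> by (simp add: powr_mult_base dist_norm mult.commute)
  ultimately show ?thesis by (simp add: inner_diff_right mult.assoc)
qed

lemma norm_N_sq: "(norm (N y))\<^sup>2 = (1 + (norm (grad y))\<^sup>2) / q\<^sup>2"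
  by (simp add: norm_xprime_xlast[of "N y"] power_mult_distrib power_divide add_divide_distrib)

lemma grad_norm_bounds:
  assumes y: "y \<in> cball 0 1"
  shows "1 + (norm (grad y))\<^sup>2 \<le> B\<^sup>2 * q\<^sup>2" "q\<^sup>2 \<le> B\<^sup>2 * (1 + (norm (grad y))\<^sup>2)"
proof -
  have "norm (grad y - grad 0) \<le> s * dist y 0 powr \<alpha>" using y by (intro grad_holder) auto
  also have "\<dots> \<le> s * 1" using y \<alpha> s_nonneg by (intro mult_left_mono powr_le1) auto
  finally have d: "norm (grad y - grad 0) \<le> s" by simp
  have B2: "B\<^sup>2 = 2 + 2 * s\<^sup>2" by (simp add: B_def)
  have q2: "q\<^sup>2 = 1 + (norm (grad 0))\<^sup>2" by (simp add: q_def)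
  have aux: "1 + a\<^sup>2 \<le> (2 + 2 * s\<^sup>2) * (1 + b\<^sup>2)" if ab: "0 \<le> a" "a \<le> b + s" "0 \<le> b" for a b :: real
  proof -
    have "a\<^sup>2 \<le> (b + s)\<^sup>2" using ab by (intro power_mono) auto
    also have "\<dots> \<le> 2 * b\<^sup>2 + 2 * s\<^sup>2" using sum_squares_bound[of b s] by (simp add: power2_sum)
    finally have "1 + a\<^sup>2 \<le> 1 + 2 * b\<^sup>2 + 2 * s\<^sup>2" by simp
    also have "\<dots> \<le> (2 + 2 * s\<^sup>2) * (1 + b\<^sup>2)" by (simp add: algebra_simps)
    finally show ?thesis .
  qed
  have "norm (grad y) \<le> norm (grad 0) + s" "norm (grad 0) \<le> norm (grad y) + s"
    using d norm_triangle_ineq2[of "grad y" "grad 0"] norm_triangle_ineq3[of "grad y" "grad 0"] by linarith+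
  then show "1 + (norm (grad y))\<^sup>2 \<le> B\<^sup>2 * q\<^sup>2" "q\<^sup>2 \<le> B\<^sup>2 * (1 + (norm (grad y))\<^sup>2)"
    unfolding B2 q2 by (auto intro!: aux)
qed

lemma norm_N_bounds:
  assumes y: "y \<in> cball 0 1"
  shows "norm (N y) \<le> B" "1 / B\<^sup>2 \<le> (norm (N y))\<^sup>2"
proof -
  have q2: "0 < q\<^sup>2" and B2: "0 < B\<^sup>2" using q_pos B_pos by simp_all
  have "(norm (N y))\<^sup>2 \<le> B\<^sup>2"
    using grad_norm_bounds(1)[OF y] unfolding norm_N_sq pos_divide_le_eq[OF q2] .
  then show "norm (N y) \<le> B" using B_pos by (auto intro: power2_le_imp_le[of _ B])
  have "q\<^sup>2 \<le> (1 + (norm (grad y))\<^sup>2) * B\<^sup>2" using grad_norm_bounds(2)[OF y] by (simp only: mult.commute)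
  then show "1 / B\<^sup>2 \<le> (norm (N y))\<^sup>2"
    unfolding norm_N_sq pos_divide_le_eq[OF B2] times_divide_eq_left pos_le_divide_eq[OF q2] by simp
qed

text \<open>\<open>N\<close> is parallel to the unit normal, so the product is the length of
  \<open>N\<close>. It is the jump of the normal derivative of \<open>D\<^sub>+\<close> across the
  graph.\<close>

lemma N_inner_normal:
  assumes y: "xprime x \<in> cball 0 1"
  shows "1 / B \<le> N (xprime x) \<bullet> normal \<psi> x"
proof -
  define t where "t = sqrt (1 + (norm (grad (xprime x)))\<^sup>2)"
  have t: "t > 0" "t\<^sup>2 = 1 + (norm (grad (xprime x)))\<^sup>2" by (simp_all add: t_def add_pos_nonneg)
  have n: "xlast (normal \<psi> x) = 1 / t" "xprime (normal \<psi> x) = (- 1 / t) *\<^sub>R grad (xprime x)"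
    by (simp_all add: normal_def xlast_def xprime_def Let_def t_def vec_eq_iff)
  have "N (xprime x) \<bullet> normal \<psi> x = (1 + (norm (grad (xprime x)))\<^sup>2) / (q * t)"
    unfolding inner_xprime_xlast[of "N (xprime x)"] n xlast_N xprime_N inner_scaleR_left inner_scaleR_right dot_square_norm
    by (simp add: add_divide_distrib)
  also have "\<dots> = (t * t) / (q * t)" using t(2) by (simp add: power2_eq_square)
  also have "\<dots> = t / q" using t(1) by simp
  finally have eq: "N (xprime x) \<bullet> normal \<psi> x = t / q" .
  have "q\<^sup>2 \<le> (B * t)\<^sup>2" using grad_norm_bounds(2)[OF y] t(2) by (simp add: power_mult_distrib)
  then have "q \<le> B * t" using B_pos t(1) by (auto intro: power2_le_imp_le[of q])
  then show ?thesis unfolding eq using B_pos q_pos by (simp add: divide_le_eq le_divide_eq mult.commute)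
qed

lemma D_taylor:
  assumes y: "y \<in> cball 0 1" and x: "xprime x \<in> cball 0 1"
  shows "\<bar>D x - N y \<bullet> (x - graph_pt y)\<bar> \<le> s * norm (xprime x - y) powr (1 + \<alpha>)"
proof -
  have "D x - N y \<bullet> (x - graph_pt y) = - (\<psi> (xprime x) - \<psi> y - grad y \<bullet> (xprime x - y)) / q"
    by (simp add: D_def inner_xprime_xlast[of "N y"] diff_divide_distrib add_divide_distrib)
  then have "\<bar>D x - N y \<bullet> (x - graph_pt y)\<bar> = \<bar>\<psi> (xprime x) - \<psi> y - grad y \<bullet> (xprime x - y)\<bar> / q"
    using q_pos by simp
  also have "\<dots> \<le> \<bar>\<psi> (xprime x) - \<psi> y - grad y \<bullet> (xprime x - y)\<bar>"
    using q_ge_1 q_pos by (simp add: divide_le_eq mult_le_cancel_left1)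
  also have "\<dots> \<le> s * norm (xprime x - y) powr (1 + \<alpha>)"
    using psi_taylor[OF y x] by (simp add: dist_norm)
  finally show ?thesis .
qed

lemma D_has_derivative:
  assumes x: "xprime x \<in> cball 0 1" and S: "xprime ` S \<subseteq> cball 0 1"
  shows "(D has_derivative (\<lambda>h. N (xprime x) \<bullet> h)) (at x within S)"
proof -
  have xp: "(xprime has_derivative xprime) (at x within S)"
    by (intro linear_imp_has_derivative linear_xprime)
  have xl: "(xlast has_derivative xlast) (at x within S)"
    by (intro linear_imp_has_derivative linear_xlast)
  have "(\<psi> has_derivative (\<lambda>h. grad (xprime x) \<bullet> h)) (at (xprime x) within xprime ` S)"
    using has_derivative_subset[OF psi_has_derivative[OF x] S] .
  from has_derivative_in_compose[OF xp this]
  have "((\<lambda>x. \<psi> (xprime x)) has_derivative (\<lambda>h. grad (xprime x) \<bullet> xprime h)) (at x within S)" .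
  from has_derivative_mult_right[OF has_derivative_diff[OF xl this], of "1 / q"]
  have "((\<lambda>x. 1 / q * (xlast x - \<psi> (xprime x))) has_derivative
      (\<lambda>h. 1 / q * (xlast h - grad (xprime x) \<bullet> xprime h))) (at x within S)" .
  moreover have "1 / q * (xlast h - grad (xprime x) \<bullet> xprime h) = N (xprime x) \<bullet> h" for h
    unfolding inner_xprime_xlast[of "N (xprime x)"] xlast_N xprime_N inner_scaleR_left by (simp add: diff_divide_distrib)
  moreover have "1 / q * (xlast x - \<psi> (xprime x)) = D x" for x by (simp add: D_def)
  ultimately show ?thesis by simp
qed

lemma graph_pt_continuous: "continuous_on (cball 0 1) graph_pt"
  unfolding graph_pt_def
proof (intro continuous_on_vec_lambda)
  fix j :: "'m option"
  show "continuous_on (cball 0 1) (\<lambda>y. case j of None \<Rightarrow> \<psi> y | Some i \<Rightarrow> y $ i)"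
    by (cases j) (auto intro: psi_continuous continuous_intros)
qed

lemma N_continuous: "continuous_on (cball 0 1) N"
  unfolding N_def
proof (intro continuous_on_vec_lambda)
  fix j :: "'m option"
  show "continuous_on (cball 0 1) (\<lambda>y. case j of None \<Rightarrow> 1 / q | Some i \<Rightarrow> - (grad y $ i) / q)"
    using q_pos by (cases j) (auto intro!: continuous_intros grad_continuous)
qed

end

section \<open>The barrier\<close>

text \<open>For small \<open>h\<close> the stronger singularity \<open>h powr (\<beta> - 1)\<close>
  wins. Past the threshold \<open>h powr \<beta> = a / b\<close> the other power, whose exponent is
  also negative, is at most its value at the threshold.\<close>

lemma powr_combination_lower_bound:
  fixes a b h \<beta> :: real
  assumes ab: "0 < a" "0 < b" and \<beta>: "0 < \<beta>" "2 * \<beta> < 1" and h: "0 < h"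
  shows "- (b * (a / b) powr ((2 * \<beta> - 1) / \<beta>)) \<le> a * h powr (\<beta> - 1) - b * h powr (2 * \<beta> - 1)"
proof -
  have eq: "h powr (2 * \<beta> - 1) = h powr (\<beta> - 1) * h powr \<beta>" by (simp add: powr_add[symmetric])
  show ?thesis
  proof (cases "b * h powr \<beta> \<le> a")
    case True
    then have "0 \<le> h powr (\<beta> - 1) * (a - b * h powr \<beta>)" by simp
    also have "\<dots> = a * h powr (\<beta> - 1) - b * h powr (2 * \<beta> - 1)"
      unfolding eq right_diff_distrib by (simp add: mult_ac)
    finally show ?thesis using ab by (smt (verit) mult_nonneg_nonneg powr_ge_zero)
  next
    case False
    then have "a / b \<le> h powr \<beta>" using ab by (simp add: divide_le_eq mult.commute)
    then have "(h powr \<beta>) powr ((2 * \<beta> - 1) / \<beta>) \<le> (a / b) powr ((2 * \<beta> - 1) / \<beta>)"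
      using ab \<beta> by (intro powr_mono2') (auto simp: divide_nonpos_pos)
    moreover have "(h powr \<beta>) powr ((2 * \<beta> - 1) / \<beta>) = h powr (2 * \<beta> - 1)" using \<beta> by (simp add: powr_powr)
    ultimately have "b * h powr (2 * \<beta> - 1) \<le> b * (a / b) powr ((2 * \<beta> - 1) / \<beta>)" using ab by simp
    moreover have "0 \<le> a * h powr (\<beta> - 1)" using ab by simp
    ultimately show ?thesis by linarith
  qed
qed

context C1alpha_interface
begin

text \<open>Large enough for two purposes: \<open>K \<ge> B + B * B\<close> makes \<open>w y\<close>
  nonpositive at distance at least 1 from the base point, and \<open>K \<ge> (1 + B) * s\<close>
  makes it nonpositive below the graph.\<close>

definition "K = (1 + B) * (B + s)"

definition h :: "real^'m \<Rightarrow> real^('m option) \<Rightarrow> real" where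
  "h y x = N y \<bullet> (x - graph_pt y)"

text \<open>The last term absorbs the error \<open>O(|x - graph_pt y| powr (1 + \<alpha>))\<close> of the tangent plane \<open>h\<close>, so \<open>w \<le> 0\<close>
  below the graph. The exponent \<open>1 + \<alpha> / 2\<close> in the middle term is smaller, so its positive second derivative
  outweighs the Hessian of the last term near the graph.\<close>

definition w :: "real^'m \<Rightarrow> real^('m option) \<Rightarrow> real" where
  "w y x = h y x + (max 0 (h y x)) powr (1 + \<alpha> / 2) - K * norm (x - graph_pt y) powr (1 + \<alpha>)"

definition W :: "real^('m option) \<Rightarrow> real" where
  "W x = Sup ((\<lambda>y. max 0 (w y x)) ` cball 0 1)"

text \<open>The constant of \<open>powr_combination_lower_bound\<close> for \<open>\<beta> = \<alpha> / 2\<close>.\<close>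

definition barrier_const :: "real \<Rightarrow> real \<Rightarrow> real \<Rightarrow> real" where
  "barrier_const lam Lam n =
    (let a = lam * (\<alpha> / 2 * (1 + \<alpha> / 2)) / (2 * B\<^sup>2); b = Lam * n * K * (1 + \<alpha>) * B
     in b * (a / b) powr ((2 * (\<alpha> / 2) - 1) / (\<alpha> / 2)))"

lemma K_pos: "0 < K" using B_pos s_nonneg by (simp add: K_def add_pos_nonneg)

lemma w_continuous: "continuous_on (cball 0 1 \<times> UNIV) (\<lambda>z. w (fst z) (snd z))"
proof -
  have N: "continuous_on (cball 0 1 \<times> S) (\<lambda>z. N (fst z))"
    and G: "continuous_on (cball 0 1 \<times> S) (\<lambda>z. graph_pt (fst z))" for S :: "(real^('m option)) set"
    by (rule continuous_on_compose2[OF N_continuous continuous_on_fst[OF continuous_on_id]], auto)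
       (rule continuous_on_compose2[OF graph_pt_continuous continuous_on_fst[OF continuous_on_id]], auto)
  show ?thesis unfolding w_def h_def
    by (intro continuous_intros continuous_on_powr' N G ballI) (use \<alpha> in auto)
qed

lemma W_attained: "\<exists>y\<in>cball 0 1. W x = max 0 (w y x)"
  and W_ge: "y \<in> cball 0 1 \<Longrightarrow> w y x \<le> W x"
proof -
  have "continuous_on (cball 0 1) ((\<lambda>z. w (fst z) (snd z)) \<circ> (\<lambda>y. (y, x)))"
    by (intro continuous_on_compose continuous_intros continuous_on_subset[OF w_continuous]) auto
  then have "continuous_on (cball 0 1) (\<lambda>y. max 0 (w y x))" by (intro continuous_intros) (simp add: o_def)
  from continuous_attains_sup[OF _ _ this] obtain y0 where
    y0: "y0 \<in> cball 0 1" "\<And>y. y \<in> cball 0 1 \<Longrightarrow> max 0 (w y x) \<le> max 0 (w y0 x)" by auto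
  have W: "W x = max 0 (w y0 x)" unfolding W_def
    by (rule cSup_eq_maximum) (use y0 in auto)
  then show "\<exists>y\<in>cball 0 1. W x = max 0 (w y x)" using y0(1) by blast
  show "w y x \<le> W x" if "y \<in> cball 0 1" using y0(2)[OF that] W by simp
qed

lemma W_nonneg: "0 \<le> W x"
  using W_attained[of x] by auto

text \<open>A supremum of continuous functions is lower semicontinuous for free, but
  \<open>W\<close> enters \<open>v\<close> with a minus sign, so the other half is needed too. It
  comes from uniform continuity of \<open>w\<close> jointly in base point and argument.\<close>

lemma W_continuous: "continuous_on (cball 0 1) W"
proof -
  have "uniformly_continuous_on (cball 0 1 \<times> cball 0 1) (\<lambda>z. w (fst z) (snd z))"
    by (rule compact_uniformly_continuous[OF continuous_on_subset[OF w_continuous]])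
       (auto intro: compact_Times)
  note uc = this[unfolded uniformly_continuous_on_def, rule_format]
  show ?thesis unfolding continuous_on_iff
  proof (intro ballI allI impI)
    fix x :: "real^('m option)" and e :: real assume x: "x \<in> cball 0 1" and e: "0 < e"
    have "0 < e / 2" using e by simp
    from uc[OF this] obtain d where d: "d > 0"
      "\<And>z z'. z \<in> cball 0 1 \<times> cball 0 1 \<Longrightarrow> z' \<in> cball 0 1 \<times> cball 0 1 \<Longrightarrow> dist z' z < d \<Longrightarrow>
         dist (w (fst z') (snd z')) (w (fst z) (snd z)) < e / 2" by blast
    have le: "W a \<le> W b + e / 2" if ab: "a \<in> cball 0 1" "b \<in> cball 0 1" "dist a b < d" for a b
    proof -
      obtain y where y: "y \<in> cball 0 1" "W a = max 0 (w y a)" using W_attained by blast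
      have "dist (y, a) (y, b) < d" using ab(3) by (simp add: dist_Pair_Pair)
      from d(2)[OF _ _ this] y ab have "\<bar>w y a - w y b\<bar> < e / 2" by (auto simp: dist_real_def)
      then have "w y a \<le> W b + e / 2" using W_ge[OF y(1), of b] by linarith
      then show ?thesis using y(2) W_nonneg[of b] e by simp
    qed
    have "dist (W x') (W x) < e" if "x' \<in> cball 0 1" "dist x' x < d" for x'
      using le[of x' x] le[of x x'] that x e by (simp add: dist_real_def dist_commute abs_less_iff)
    then show "\<exists>d>0. \<forall>x'\<in>cball 0 1. dist x' x < d \<longrightarrow> dist (W x') (W x) < e" using d(1) by blast
  qed
qed

lemma h_le:
  assumes "y \<in> cball 0 1"
  shows "h y x \<le> B * norm (x - graph_pt y)"
proof -
  have "h y x \<le> norm (N y) * norm (x - graph_pt y)" unfolding h_def by (rule norm_cauchy_schwarz)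
  also have "\<dots> \<le> B * norm (x - graph_pt y)" using norm_N_bounds(1)[OF assms] by (intro mult_right_mono) auto
  finally show ?thesis .
qed

lemma w_le_0_of_h_le_0:
  assumes "h y x \<le> 0"
  shows "w y x \<le> 0"
proof -
  have "max 0 (h y x) = 0" using assms by simp
  moreover have "0 \<le> K * norm (x - graph_pt y) powr (1 + \<alpha>)" using K_pos by simp
  ultimately show ?thesis using assms \<alpha> by (simp add: w_def)
qed

text \<open>At distance \<open>t \<ge> 1\<close> from the base point the highest power dominates:
  the first two terms of \<open>w\<close> are at most \<open>B\<close> and \<open>B * B\<close>
  times \<open>t powr (1 + \<alpha>)\<close>.\<close>

lemma w_pos_imp:
  assumes y: "y \<in> cball 0 1" and pos: "0 < w y x"
  shows "0 < h y x" "norm (x - graph_pt y) < 1"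
proof -
  show hp: "0 < h y x" using w_le_0_of_h_le_0[of y x] pos by linarith
  define t where "t = norm (x - graph_pt y)"
  have hB: "h y x \<le> B * t" using h_le[OF y] by (simp add: t_def)
  show "norm (x - graph_pt y) < 1"
  proof (rule ccontr)
    assume "\<not> norm (x - graph_pt y) < 1"
    then have t: "1 \<le> t" by (simp add: t_def)
    have "t powr 1 \<le> t powr (1 + \<alpha>)" using t \<alpha> by (intro powr_mono) auto
    then have "B * t \<le> B * t powr (1 + \<alpha>)" using t B_pos by (intro mult_left_mono) auto
    then have h1: "h y x \<le> B * t powr (1 + \<alpha>)" using hB by linarith
    have "h y x powr (1 + \<alpha> / 2) \<le> (B * t) powr (1 + \<alpha> / 2)" using hp hB \<alpha> by (intro powr_mono2) auto
    also have "\<dots> = B powr (1 + \<alpha> / 2) * t powr (1 + \<alpha> / 2)" using t B_pos by (simp add: powr_mult)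
    also have "\<dots> \<le> B powr 2 * t powr (1 + \<alpha>)"
      using t \<alpha> B_ge_1 by (intro mult_mono powr_mono) auto
    also have "B powr 2 = B * B" using B_pos by (simp add: power2_eq_square)
    finally have h2: "h y x powr (1 + \<alpha> / 2) \<le> B * B * t powr (1 + \<alpha>)" .
    have "(B + B * B) * t powr (1 + \<alpha>) \<le> K * t powr (1 + \<alpha>)"
      using s_nonneg B_pos by (intro mult_right_mono) (auto simp: K_def algebra_simps)
    then have "B * t powr (1 + \<alpha>) + B * B * t powr (1 + \<alpha>) \<le> K * t powr (1 + \<alpha>)"
      by (simp only: distrib_right)
    then have "w y x \<le> 0" using h1 h2 hp by (simp add: w_def t_def[symmetric])
    then show False using pos by simp
  qed
qed

text \<open>Makes the middle term of \<open>w\<close> linear in \<open>h\<close>, so that only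
  \<open>h\<close> has to be estimated afterwards.\<close>

lemma powr_h_le:
  assumes y: "y \<in> cball 0 1" and hp: "0 < h y x" and t: "norm (x - graph_pt y) \<le> 1"
  shows "h y x \<le> B" "h y x powr (1 + \<alpha> / 2) \<le> h y x * B"
proof -
  have "B * norm (x - graph_pt y) \<le> B * 1" using t B_pos by (intro mult_left_mono) auto
  then show hB: "h y x \<le> B" using h_le[OF y, of x] by linarith
  have "h y x powr (\<alpha> / 2) \<le> B powr (\<alpha> / 2)" using hp hB \<alpha> by (intro powr_mono2) auto
  also have "\<dots> \<le> B powr 1" using \<alpha> B_ge_1 by (intro powr_mono) auto
  finally have "h y x powr (\<alpha> / 2) \<le> B" using B_pos by simp
  then have "h y x * h y x powr (\<alpha> / 2) \<le> h y x * B" using hp by (intro mult_left_mono) auto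
  then show "h y x powr (1 + \<alpha> / 2) \<le> h y x * B" using hp by (simp add: powr_mult_base)
qed

lemma W_le: "W x \<le> B + B * B"
proof -
  obtain y where y: "y \<in> cball 0 1" "W x = max 0 (w y x)" using W_attained by blast
  have "w y x \<le> B + B * B" if pos: "0 < w y x"
  proof -
    note p = w_pos_imp[OF y(1) pos]
    note q = powr_h_le[OF y(1) p(1) less_imp_le[OF p(2)]]
    have "h y x * B \<le> B * B" using q(1) B_pos by (intro mult_right_mono) auto
    moreover have "0 \<le> K * norm (x - graph_pt y) powr (1 + \<alpha>)" using K_pos by simp
    moreover have "max 0 (h y x) = h y x" using p(1) by simp
    ultimately show ?thesis using q unfolding w_def by linarith
  qed
  then show ?thesis using y(2) B_pos by (cases "0 < w y x") auto
qed

text \<open>Where \<open>D \<le> 0\<close>, Taylor's formula bounds \<open>h\<close> by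
  \<open>s\<close> times the power in the last term of \<open>w\<close>. The first two terms add up
  to at most \<open>(1 + B) * h\<close>, which \<open>K\<close> was chosen to absorb.\<close>

lemma W_eq_0:
  assumes x: "xprime x \<in> cball 0 1" and D: "D x \<le> 0"
  shows "W x = 0"
proof -
  have "w y x \<le> 0" if y: "y \<in> cball 0 1" for y
  proof (rule ccontr)
    assume "\<not> w y x \<le> 0"
    then have pos: "0 < w y x" by simp
    note p = w_pos_imp[OF y pos]
    note q = powr_h_le[OF y p(1) less_imp_le[OF p(2)]]
    define T where "T = norm (x - graph_pt y) powr (1 + \<alpha>)"
    have "norm (xprime x - y) \<le> norm (x - graph_pt y)" using norm_xprime_le[of "x - graph_pt y"] by simp
    then have "s * norm (xprime x - y) powr (1 + \<alpha>) \<le> s * T" unfolding T_def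
      using s_nonneg \<alpha> by (intro mult_left_mono powr_mono2) auto
    then have hs: "h y x \<le> s * T" using D_taylor[OF y x] D by (simp add: h_def)
    have "h y x * (1 + B) \<le> s * T * (1 + B)" using hs B_pos by (intro mult_right_mono) auto
    also have "\<dots> \<le> K * T" using B_pos s_nonneg by (simp add: K_def T_def algebra_simps)
    finally have "w y x \<le> 0" using q(2) p(1) by (simp add: w_def T_def[symmetric] algebra_simps)
    then show False using pos by simp
  qed
  moreover obtain y where "y \<in> cball 0 1" "W x = max 0 (w y x)" using W_attained by blast
  ultimately show ?thesis by (simp add: max_absorb1)
qed

lemma W_ge_half_D:
  assumes x0: "x0 \<in> ball 0 1" and D0: "D x0 = 0"
  shows "\<exists>\<delta>>0. \<forall>x\<in>ball x0 \<delta> \<inter> ball 0 1. D x / 2 \<le> W x"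
proof -
  \<comment> \<open>Solves \<open>K * (q * d) powr (1 + \<alpha>) = d / 2\<close>. The dependence on
    \<open>\<psi>\<close> through \<open>q\<close> is harmless, as \<open>d\<close> only fixes the
    size of a neighbourhood.\<close>
  define d where "d = (1 / (2 * K * q powr (1 + \<alpha>))) powr (1 / \<alpha>)"
  have d: "d > 0" using K_pos q_pos by (simp add: d_def)
  have xp: "xprime x \<in> cball 0 1" if "x \<in> ball 0 1" for x :: "real^('m option)"
    using that xprime_in_cball[of x] by simp
  have "(D has_derivative (\<lambda>h. N (xprime x0) \<bullet> h)) (at x0 within ball 0 1)"
    using xp x0 by (intro D_has_derivative) auto
  then have "continuous (at x0 within ball 0 1) D" by (rule has_derivative_continuous)
  then obtain \<delta> where \<delta>: "\<delta> > 0" "\<And>x. x \<in> ball 0 1 \<Longrightarrow> dist x x0 < \<delta> \<Longrightarrow> dist (D x) (D x0) < d"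
    using d unfolding continuous_within_eps_delta by blast
  have "D x / 2 \<le> W x" if x: "x \<in> ball x0 \<delta> \<inter> ball 0 1" for x
  proof (cases "D x \<le> 0")
    case True
    then show ?thesis using W_nonneg[of x] by linarith
  next
    case False
    then have Dp: "D x > 0" by simp
    have Dd: "D x < d" using \<delta>(2)[of x] x D0 Dp by (simp add: dist_real_def dist_commute)
    \<comment> \<open>For the graph point vertically below \<open>x\<close> the tangent plane gives
      the height exactly, \<open>h y x = D x\<close>, and only the last term of \<open>w\<close> is
      lost.\<close>
    define y where "y = xprime x"
    have y: "y \<in> cball 0 1" using xp x by (simp add: y_def)
    define z where "z = x - graph_pt y"
    have z: "xprime z = 0" "xlast z = q * D x" using q_pos by (simp_all add: z_def y_def D_def)
    have h: "h y x = D x" unfolding h_def z_def[symmetric] inner_xprime_xlast[of "N y"] using z q_pos by simp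
    have "(norm z)\<^sup>2 = (q * D x)\<^sup>2" using norm_xprime_xlast[of z] z by simp
    then have nz: "norm z = q * D x" using q_pos Dp by simp
    have "D x powr \<alpha> \<le> d powr \<alpha>" using Dp Dd \<alpha> by (intro powr_mono2) auto
    also have "\<dots> = 1 / (2 * K * q powr (1 + \<alpha>))" using \<alpha> K_pos q_pos by (simp add: d_def powr_powr)
    finally have "K * q powr (1 + \<alpha>) * D x powr \<alpha> \<le> 1 / 2" using K_pos q_pos by (simp add: field_simps)
    then have "D x * (K * q powr (1 + \<alpha>) * D x powr \<alpha>) \<le> D x * (1 / 2)" using Dp by (intro mult_left_mono) auto
    moreover have "K * norm z powr (1 + \<alpha>) = D x * (K * q powr (1 + \<alpha>) * D x powr \<alpha>)"
      using q_pos Dp by (simp add: nz powr_mult powr_add)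
    moreover have "0 \<le> D x powr (1 + \<alpha> / 2)" "max 0 (D x) = D x" using Dp by simp_all
    ultimately have "D x / 2 \<le> w y x" unfolding w_def h z_def[symmetric] by linarith
    then show ?thesis using W_ge[OF y, of x] by linarith
  qed
  then show ?thesis using \<delta>(1) by blast
qed

lemma barrier_const_nonneg:
  assumes "0 < lam" "0 < Lam" "0 < n"
  shows "0 \<le> barrier_const lam Lam n"
  using assms \<alpha> B_pos K_pos by (simp add: barrier_const_def Let_def)

text \<open>If \<open>W x > 0\<close>, a maximising \<open>w y\<close> touches \<open>W\<close> from
  below at \<open>x\<close>. Its middle term supplies convexity along \<open>N y\<close>, its last
  term an isotropic concave part. Both curvatures blow up near the graph, but
  \<open>powr_combination_lower_bound\<close> bounds their balance uniformly.\<close>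

lemma W_touched_below:
  assumes lam: "0 < lam" "0 < Lam" and n: "0 < n"
  shows "\<exists>p e c2 c3 \<delta>. 0 \<le> c2 \<and> 0 \<le> c3 \<and> 0 < \<delta> \<and>
      (\<forall>x'\<in>ball x \<delta>. W x + p \<bullet> (x' - x) + c2 * (e \<bullet> (x' - x))\<^sup>2 - c3 * ((x' - x) \<bullet> (x' - x)) \<le> W x') \<and>
      - barrier_const lam Lam n \<le> 2 * (lam * (c2 * (norm e)\<^sup>2) - Lam * n * c3)"
proof (cases "W x = 0")
  case True
  then show ?thesis
    using W_nonneg barrier_const_nonneg[OF lam n]
    by (intro exI[of _ 0] exI[of _ 0] exI[of _ "0::real"] exI[of _ "0::real"] exI[of _ "1::real"]) auto
next
  case False
  obtain y where y: "y \<in> cball 0 1" "W x = max 0 (w y x)" using W_attained by blast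
  have pos: "0 < w y x" using False y(2) by (auto simp: max_def split: if_splits)
  have Wx: "W x = w y x" using y(2) pos by simp
  note p = w_pos_imp[OF y(1) pos]
  define z where "z = x - graph_pt y"
  define h0 where "h0 = h y x"
  have h0: "0 < h0" "h0 \<le> B * norm z" using p h_le[OF y(1), of x] by (auto simp: h0_def z_def)
  have z0: "z \<noteq> 0" using h0 by auto
  define \<beta> where "\<beta> = \<alpha> / 2"
  have \<beta>: "0 < \<beta>" "\<beta> < 1" "2 * \<beta> < 1" "\<alpha> = 2 * \<beta>" using \<alpha> by (auto simp: \<beta>_def)
  define c2 where "c2 = \<beta> * (1 + \<beta>) / 4 * h0 powr (\<beta> - 1)"
  define c3 where "c3 = K * ((1 + \<alpha>) / 2 * norm z powr (\<alpha> - 1))"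
  define pv where "pv = (1 + (1 + \<beta>) * h0 powr \<beta>) *\<^sub>R N y - (2 * c3) *\<^sub>R z"
  \<comment> \<open>Within this radius \<open>N y \<bullet> (x' - x)\<close> stays below
    \<open>h0\<close> in absolute value, so \<open>h y x'\<close> remains in the range
    \<open>(0, 2 * h0]\<close> of the quadratic lower bound.\<close>
  define \<delta> where "\<delta> = h0 / B"
  have c: "0 \<le> c2" "0 \<le> c3" "0 < \<delta>" using \<beta> \<alpha> K_pos h0 B_pos by (auto simp: c2_def c3_def \<delta>_def)
  have touch: "W x + pv \<bullet> (x' - x) + c2 * (N y \<bullet> (x' - x))\<^sup>2 - c3 * ((x' - x) \<bullet> (x' - x)) \<le> W x'"
    if x': "x' \<in> ball x \<delta>" for x'
  proof -
    define v where "v = x' - x"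
    have hv: "h y x' = h0 + N y \<bullet> v" by (simp add: h_def h0_def v_def inner_diff_right)
    have "\<bar>N y \<bullet> v\<bar> \<le> norm (N y) * norm v" by (rule Cauchy_Schwarz_ineq2)
    also have "\<dots> \<le> B * norm v" using norm_N_bounds(1)[OF y(1)] by (intro mult_right_mono) auto
    also have "\<dots> < B * \<delta>" using x' B_pos by (simp add: v_def dist_norm norm_minus_commute)
    also have "\<dots> = h0" using B_pos by (simp add: \<delta>_def)
    finally have hh: "0 < h y x'" "h y x' \<le> 2 * h0" unfolding hv by linarith+
    have 1: "h0 powr (1 + \<beta>) + (1 + \<beta>) * h0 powr \<beta> * (N y \<bullet> v) + c2 * (N y \<bullet> v)\<^sup>2 \<le> h y x' powr (1 + \<beta>)"
      using powr_tangent_quadratic_below[OF \<beta>(1,2) hh h0(1)] by (simp add: hv c2_def)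
    have 2: "norm (z + v) powr (1 + \<alpha>) \<le> norm z powr (1 + \<alpha>)
        + (1 + \<alpha>) / 2 * norm z powr (\<alpha> - 1) * (2 * (z \<bullet> v) + v \<bullet> v)"
      by (rule norm_powr_above_quadratic[OF \<alpha> z0])
    have "K * norm (z + v) powr (1 + \<alpha>) \<le> K * (norm z powr (1 + \<alpha>)
        + (1 + \<alpha>) / 2 * norm z powr (\<alpha> - 1) * (2 * (z \<bullet> v) + v \<bullet> v))"
      using 2 K_pos by (intro mult_left_mono) auto
    also have "\<dots> = K * norm z powr (1 + \<alpha>) + c3 * (2 * (z \<bullet> v) + v \<bullet> v)"
      by (simp add: c3_def algebra_simps)
    finally have 3: "K * norm (z + v) powr (1 + \<alpha>) \<le> K * norm z powr (1 + \<alpha>) + 2 * c3 * (z \<bullet> v) + c3 * (v \<bullet> v)"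
      by (simp add: algebra_simps)
    have "z + v = x' - graph_pt y" by (simp add: z_def v_def)
    then have wx': "w y x' = h y x' + h y x' powr (1 + \<beta>) - K * norm (z + v) powr (1 + \<alpha>)"
      using hh by (simp add: w_def \<beta>_def)
    have wx: "w y x = h0 + h0 powr (1 + \<beta>) - K * norm z powr (1 + \<alpha>)"
      using h0 by (simp add: w_def \<beta>_def h0_def z_def)
    have "pv \<bullet> v = N y \<bullet> v + (1 + \<beta>) * h0 powr \<beta> * (N y \<bullet> v) - 2 * c3 * (z \<bullet> v)"
      by (simp add: pv_def inner_diff_left distrib_right)
    then have "w y x + pv \<bullet> v + c2 * (N y \<bullet> v)\<^sup>2 - c3 * (v \<bullet> v) \<le> w y x'"
      using 1 3 hv wx wx' by linarith
    then show ?thesis using W_ge[OF y(1), of x'] Wx by (simp add: v_def)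
  qed
  have "- barrier_const lam Lam n \<le> 2 * (lam * (c2 * (norm (N y))\<^sup>2) - Lam * n * c3)"
  proof -
    define a where "a = lam * (\<beta> * (1 + \<beta>)) / (2 * B\<^sup>2)"
    define b where "b = Lam * n * K * (1 + \<alpha>) * B"
    have ab: "0 < a" "0 < b" using lam n \<beta> \<alpha> B_pos K_pos by (auto simp: a_def b_def)
    have bc: "barrier_const lam Lam n = b * (a / b) powr ((2 * \<beta> - 1) / \<beta>)"
      by (simp add: barrier_const_def Let_def a_def b_def \<beta>_def)
    \<comment> \<open>Expresses the curvature of the last term through \<open>h0\<close>; the
      exponent \<open>\<alpha> - 1\<close> is negative, so a lower bound on \<open>norm z\<close> is
      what is needed.\<close>
    have "h0 / B \<le> norm z" using h0 B_pos by (simp add: divide_le_eq mult.commute)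
    then have "norm z powr (\<alpha> - 1) \<le> (h0 / B) powr (\<alpha> - 1)"
      using h0 B_pos \<alpha> by (intro powr_mono2') auto
    also have "\<dots> = h0 powr (\<alpha> - 1) * B powr (1 - \<alpha>)"
      using h0 B_pos by (simp add: powr_divide powr_minus_divide[of B "1 - \<alpha>", simplified] divide_simps)
    also have "\<dots> \<le> h0 powr (\<alpha> - 1) * B powr 1" using \<alpha> B_ge_1 by (intro mult_left_mono powr_mono) auto
    finally have z1: "norm z powr (\<alpha> - 1) \<le> B * h0 powr (2 * \<beta> - 1)" using B_pos \<beta>(4) by (simp add: mult.commute)
    have "Lam * n * K * (1 + \<alpha>) * norm z powr (\<alpha> - 1) \<le> Lam * n * K * (1 + \<alpha>) * (B * h0 powr (2 * \<beta> - 1))"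
      using z1 lam n K_pos \<alpha> by (intro mult_left_mono) auto
    then have t3: "2 * (Lam * n * c3) \<le> b * h0 powr (2 * \<beta> - 1)"
      by (simp add: c3_def b_def mult_ac)
    have "2 * (lam * c2) * (1 / B\<^sup>2) \<le> 2 * (lam * c2) * (norm (N y))\<^sup>2"
      using norm_N_bounds(2)[OF y(1)] lam c by (intro mult_left_mono) auto
    moreover have "2 * (lam * c2) * (1 / B\<^sup>2) = a * h0 powr (\<beta> - 1)"
      by (simp add: c2_def a_def)
    ultimately have "a * h0 powr (\<beta> - 1) - b * h0 powr (2 * \<beta> - 1) \<le> 2 * (lam * (c2 * (norm (N y))\<^sup>2) - Lam * n * c3)"
      using t3 by (simp add: mult.assoc)
    then show ?thesis
      using powr_combination_lower_bound[OF ab \<beta>(1,3) h0(1)] unfolding bc by linarith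
  qed
  then show ?thesis using c touch by blast
qed

end

section \<open>The maximum principle\<close>

lemma set_integrable_continuous_bounded:
  fixes f :: "'a::euclidean_space \<Rightarrow> real"
  assumes S: "open S" "S \<subseteq> ball 0 1" and f: "continuous_on S f" "\<And>x. x \<in> S \<Longrightarrow> \<bar>f x\<bar> \<le> M"
  shows "set_integrable lborel S f"
proof -
  have meas: "(\<lambda>x. indicator S x *\<^sub>R f x) \<in> borel_measurable lborel"
    using borel_measurable_continuous_on_indicator[OF _ f(1)] S(1) by simp
  have "emeasure lborel S < \<infinity>" by (rule emeasure_bounded_finite[OF bounded_subset[OF bounded_ball S(2)]])
  then have int: "integrable lborel (\<lambda>x. M * indicator S x)"
    using S(1) by (intro integrable_mult_right) (simp add: integrable_indicator_iff)
  show ?thesis unfolding set_integrable_def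
    by (rule Bochner_Integration.integrable_bound[OF int meas])
       (use f(2) in \<open>force simp: indicator_def\<close>)
qed

context C1alpha_interface
begin

lemma xprime_ball: "x \<in> ball 0 1 \<Longrightarrow> xprime x \<in> cball 0 1"
  using xprime_in_cball[of x] by simp

lemma D_continuous: "continuous_on (cball 0 1) D"
  unfolding continuous_on_eq_continuous_within
  by (intro ballI has_derivative_continuous[OF D_has_derivative]) (auto intro: order_trans[OF norm_xprime_le])

lemma OmegaP_eq: "OmegaP \<psi> = {x \<in> ball 0 1. D x > 0}"
  and OmegaM_eq: "OmegaM \<psi> = {x \<in> ball 0 1. D x < 0}"
  and Gamma_eq: "Gamma \<psi> = {x \<in> ball 0 1. D x = 0}"
  using q_pos by (auto simp: OmegaP_def OmegaM_def Gamma_def D_def zero_less_divide_iff divide_less_0_iff)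

lemma open_OmegaP: "open (OmegaP \<psi>)" and open_OmegaM: "open (OmegaM \<psi>)"
proof -
  have c: "continuous_on (ball 0 1) D" using D_continuous by (rule continuous_on_subset) auto
  have "OmegaP \<psi> = ball 0 1 \<inter> D -` {0<..}" "OmegaM \<psi> = ball 0 1 \<inter> D -` {..<0}"
    by (auto simp: OmegaP_eq OmegaM_eq)
  then show "open (OmegaP \<psi>)" "open (OmegaM \<psi>)"
    using continuous_open_preimage[OF c open_ball] by auto
qed

lemma closure_OmegaP: "x \<in> closure (OmegaP \<psi>) \<Longrightarrow> x \<in> cball 0 1 \<and> 0 \<le> D x"
  and closure_OmegaM: "x \<in> closure (OmegaM \<psi>) \<Longrightarrow> x \<in> cball 0 1 \<and> D x \<le> 0"
proof -
  have "closed (cball 0 1 \<inter> D -` {0..})" "closed (cball 0 1 \<inter> D -` {..0})"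
    by (intro continuous_closed_preimage D_continuous closed_cball closed_atLeast closed_atMost)+
  then have "closure (OmegaP \<psi>) \<subseteq> cball 0 1 \<inter> D -` {0..}" "closure (OmegaM \<psi>) \<subseteq> cball 0 1 \<inter> D -` {..0}"
    by (intro closure_minimal; auto simp: OmegaP_eq OmegaM_eq)+
  then show "x \<in> closure (OmegaP \<psi>) \<Longrightarrow> x \<in> cball 0 1 \<and> 0 \<le> D x"
    and "x \<in> closure (OmegaM \<psi>) \<Longrightarrow> x \<in> cball 0 1 \<and> D x \<le> 0" by auto
qed

text \<open>The jump of the test function is \<open>G / 2\<close> times a number that is at least
  \<open>1 / B\<close>, so contact would force \<open>G \<le> 2 * B * g x0\<close>. The 2 comes from
  \<open>W \<ge> D / 2\<close>, the \<open>B\<close> from \<open>N_inner_normal\<close>.\<close>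

lemma no_contact_on_Gamma:
  assumes vt: "visc_transmission \<psi> g u" and G: "0 \<le> G" "\<And>x. x \<in> Gamma \<psi> \<Longrightarrow> 2 * B * g x < G"
    and c: "contact (\<lambda>x. u x + (k - G * W x)) x0 p"
  shows "x0 \<notin> Gamma \<psi>"
proof
  assume x0: "x0 \<in> Gamma \<psi>"
  have xb: "x0 \<in> ball 0 1" and D0: "D x0 = 0" using x0 by (auto simp: Gamma_eq)
  have W0: "W x0 = 0" using W_eq_0[of x0] xprime_ball[OF xb] D0 by simp
  obtain \<delta> where \<delta>: "\<delta> > 0" "\<And>x. x \<in> ball x0 \<delta> \<inter> ball 0 1 \<Longrightarrow> D x / 2 \<le> W x"
    using W_ge_half_D[OF xb D0] by blast
  define d where "d = min \<delta> (1 - norm x0)"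
  have d: "d > 0" "d \<le> \<delta>" using \<delta>(1) xb by (auto simp: d_def)
  have sub: "ball x0 d \<subseteq> ball 0 1"
  proof
    fix x assume "x \<in> ball x0 d"
    then have "norm (x - x0) < 1 - norm x0" by (simp add: d_def dist_norm norm_minus_commute)
    then show "x \<in> ball 0 1" using norm_triangle_ineq[of "x - x0" x0] by simp
  qed
  define \<phi> where "\<phi> y = u x0 + p \<bullet> (y - x0) + G / 2 * max 0 (D y)" for y
  have cD: "continuous_on (ball x0 d) D"
    using D_continuous by (rule continuous_on_subset) (use sub in auto)
  have cphi: "continuous_on (ball x0 d) \<phi>" unfolding \<phi>_def by (intro continuous_intros cD)
  have lin: "((\<lambda>y. u x0 + p \<bullet> (y - x0)) has_derivative (\<lambda>h. p \<bullet> h)) (at x within S)" for x S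
  proof -
    have "((\<lambda>y. y - x0) has_derivative (\<lambda>h. h)) (at x within S)"
      using has_derivative_diff[OF has_derivative_ident has_derivative_const[of x0]] by simp
    from has_derivative_add[OF has_derivative_const[of "u x0"] has_derivative_inner_right[OF this, of p]]
    show ?thesis by simp
  qed
  have plus: "C1_on_with \<phi> (ball x0 d \<inter> closure (OmegaP \<psi>)) (\<lambda>y. p + (G / 2) *\<^sub>R N (xprime y))"
    unfolding C1_on_with_def
  proof (intro conjI ballI)
    let ?S = "ball x0 d \<inter> closure (OmegaP \<psi>)"
    fix x assume x: "x \<in> ?S"
    have "xprime ` ?S \<subseteq> cball 0 1" "xprime x \<in> cball 0 1" using sub x xprime_ball by blast+
    then have "(D has_derivative (\<lambda>h. N (xprime x) \<bullet> h)) (at x within ?S)" by (intro D_has_derivative)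
    from has_derivative_add[OF lin has_derivative_mult_right[OF this, of "G / 2"]]
    have "((\<lambda>y. u x0 + p \<bullet> (y - x0) + G / 2 * D y) has_derivative
        (\<lambda>h. (p + (G / 2) *\<^sub>R N (xprime x)) \<bullet> h)) (at x within ?S)"
      by (simp add: inner_add_left)
    then show "(\<phi> has_derivative (\<lambda>h. (p + (G / 2) *\<^sub>R N (xprime x)) \<bullet> h)) (at x within ?S)"
      by (rule has_derivative_transform[OF x, rotated]) (use closure_OmegaP in \<open>auto simp: \<phi>_def\<close>)
  next
    let ?S = "ball x0 d \<inter> closure (OmegaP \<psi>)"
    have "continuous_on (ball x0 d) xprime"
      using linear_continuous_on linear_xprime unfolding linear_conv_bounded_linear by blast
    moreover have "xprime ` ball x0 d \<subseteq> cball 0 1" using sub xprime_ball by blast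
    ultimately have "continuous_on (ball x0 d) (\<lambda>y. N (xprime y))"
      by (rule continuous_on_compose2[OF N_continuous])
    then show "continuous_on ?S (\<lambda>y. p + (G / 2) *\<^sub>R N (xprime y))"
      by (intro continuous_intros) (auto elim: continuous_on_subset)
  qed
  have minus: "C1_on_with \<phi> (ball x0 d \<inter> closure (OmegaM \<psi>)) (\<lambda>y. p)"
    unfolding C1_on_with_def
  proof (intro conjI ballI)
    fix x assume x: "x \<in> ball x0 d \<inter> closure (OmegaM \<psi>)"
    show "(\<phi> has_derivative (\<lambda>h. p \<bullet> h)) (at x within ball x0 d \<inter> closure (OmegaM \<psi>))"
      by (rule has_derivative_transform[OF x _ lin]) (use closure_OmegaM in \<open>auto simp: \<phi>_def max_absorb1\<close>)
  qed simp
  have "(p + (G / 2) *\<^sub>R N (xprime x0)) \<bullet> normal \<psi> x0 - p \<bullet> normal \<psi> x0 \<le> g x0"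
  proof (rule vt[unfolded visc_transmission_def, rule_format, OF x0, where \<delta> = d and \<phi> = \<phi>
        and Gp = "\<lambda>y. p + (G / 2) *\<^sub>R N (xprime y)" and Gm = "\<lambda>y. p"], intro conjI ballI)
    show "\<phi> x0 = u x0" by (simp add: \<phi>_def D0)
    fix y assume y: "y \<in> ball x0 d \<inter> ball 0 1"
    have yc: "y \<in> cball 0 1" using y by auto
    have "D y / 2 \<le> W y" using \<delta>(2)[of y] y d(2) by auto
    then have "max 0 (D y) \<le> 2 * W y" using W_nonneg[of y] by simp
    then have "G * max 0 (D y) \<le> G * (2 * W y)" using G(1) by (rule mult_left_mono)
    moreover have "u x0 + (k - G * W x0) + p \<bullet> (y - x0) \<le> u y + (k - G * W y)"
      using c yc by (simp add: contact_def)
    ultimately show "\<phi> y \<le> u y" by (simp add: \<phi>_def W0)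
  qed (use d cphi plus minus in auto)
  then have "G / 2 * (N (xprime x0) \<bullet> normal \<psi> x0) \<le> g x0" by (simp add: inner_add_left)
  moreover have "G / 2 * (1 / B) \<le> G / 2 * (N (xprime x0) \<bullet> normal \<psi> x0)"
    using G(1) N_inner_normal[OF xprime_ball[OF xb]] by (intro mult_left_mono) auto
  ultimately have "G / 2 * (1 / B) \<le> g x0" by linarith
  then have "G \<le> 2 * B * g x0" using B_pos by (simp add: field_simps)
  then show False using G(2)[OF x0] by simp
qed

text \<open>Adding \<open>G\<close> times the paraboloid below \<open>W\<close> turns a paraboloid
  below \<open>u - G W\<close> into one below \<open>u\<close>. The price is
  \<open>barrier_const\<close> times \<open>G\<close> on the right-hand side.\<close>

lemma visc_super_minus_barrier:
  assumes lam: "0 < lam" "lam \<le> Lam" and \<Omega>: "open \<Omega>"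
    and vs: "visc_super lam Lam \<Omega> f u" and z: "z \<in> \<Omega>" and G: "0 \<le> G"
    and A: "0 < A" "norm e = 1" "0 < \<delta>"
    and touch: "\<And>y. y \<in> ball z \<delta> \<Longrightarrow> u z + (k - G * W z) + p \<bullet> (y - z) + A * ((e \<bullet> (y - z))\<^sup>2
       - lam / (2 * Lam * real CARD('m option)) * ((y - z) \<bullet> (y - z))) \<le> u y + (k - G * W y)"
  shows "A * lam \<le> f z + barrier_const lam Lam (real CARD('m option)) * G"
proof -
  define n where "n = real CARD('m option)"
  \<comment> \<open>With this value the concave part costs \<open>A * lam\<close> out of the gain
    \<open>2 * A * lam\<close>, and \<open>A * lam\<close> is left.\<close>
  define kap where "kap = lam / (2 * Lam * n)"
  have n: "0 < n" by (simp add: n_def)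
  have L: "0 < Lam" using lam by simp
  obtain p' e' c2 c3 \<delta>' where W: "0 \<le> c2" "0 \<le> c3" "0 < \<delta>'"
    "\<And>y. y \<in> ball z \<delta>' \<Longrightarrow> W z + p' \<bullet> (y - z) + c2 * (e' \<bullet> (y - z))\<^sup>2 - c3 * ((y - z) \<bullet> (y - z)) \<le> W y"
    "- barrier_const lam Lam n \<le> 2 * (lam * (c2 * (norm e')\<^sup>2) - Lam * n * c3)"
    using W_touched_below[OF lam(1) L n, of z] by blast
  have kap: "0 < kap" using lam L n by (simp add: kap_def)
  have "2 * (lam * (A * (norm e)\<^sup>2 + (G * c2) * (norm e')\<^sup>2) - Lam * real CARD('m option) * (A * kap + G * c3)) \<le> f z"
  proof (rule visc_super_quadratic[OF lam _ _ _ vs z, where p = "p + G *\<^sub>R p'" and \<delta> = "min \<delta> \<delta>'"])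
    fix y assume y: "y \<in> ball z (min \<delta> \<delta>') \<inter> \<Omega>"
    define a where "a = y - z"
    have "G * (W z + p' \<bullet> a + c2 * (e' \<bullet> a)\<^sup>2 - c3 * (a \<bullet> a)) \<le> G * W y"
      using W(4)[of y] y G unfolding a_def by (intro mult_left_mono) auto
    moreover have "u z + (k - G * W z) + p \<bullet> a + A * ((e \<bullet> a)\<^sup>2 - kap * (a \<bullet> a)) \<le> u y + (k - G * W y)"
      using touch[of y] y unfolding a_def kap_def n_def by simp
    ultimately show "u z + (p + G *\<^sub>R p') \<bullet> (y - z) + A * (e \<bullet> (y - z))\<^sup>2 + G * c2 * (e' \<bullet> (y - z))\<^sup>2
        - (A * kap + G * c3) * ((y - z) \<bullet> (y - z)) \<le> u y"
      unfolding a_def[symmetric] by (simp add: inner_add_left algebra_simps)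
  qed (use A W G kap in auto)
  moreover have "Lam * n * (A * kap) = A * lam / 2" using L n by (simp add: kap_def field_simps)
  moreover have "G * (- barrier_const lam Lam n) \<le> G * (2 * (lam * (c2 * (norm e')\<^sup>2) - Lam * n * c3))"
    using W(5) G by (rule mult_left_mono)
  moreover have "2 * (lam * (A * (norm e)\<^sup>2 + (G * c2) * (norm e')\<^sup>2) - Lam * n * (A * kap + G * c3))
      = 2 * (A * lam) - 2 * (Lam * n * (A * kap)) + G * (2 * (lam * (c2 * (norm e')\<^sup>2) - Lam * n * c3))"
    by (simp add: A(2) algebra_simps)
  moreover have "G * (- barrier_const lam Lam n) = - (barrier_const lam Lam n * G)" by simp
  ultimately show ?thesis unfolding n_def[symmetric] by linarith
qed

text \<open>The term \<open>G * (B + B * B)\<close> in the condition on \<open>R\<close> is the most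
  by which subtracting \<open>G W\<close> can lower the boundary values. \<open>c\<close> collects
  the part of \<open>F + 2 * \<epsilon>\<close> that does not come from \<open>fp\<close> and
  \<open>fm\<close>.\<close>

lemma slope_radius_estimate:
  fixes u fp fm :: "real^('m option) \<Rightarrow> real"
  defines "n \<equiv> CARD('m option)"
  assumes lam: "0 < lam" "lam \<le> Lam"
    and fp: "continuous_on (OmegaP \<psi>) fp" "\<And>x. x \<in> OmegaP \<psi> \<Longrightarrow> \<bar>fp x\<bar> \<le> Mp"
    and fm: "continuous_on (OmegaM \<psi>) fm" "\<And>x. x \<in> OmegaM \<psi> \<Longrightarrow> \<bar>fm x\<bar> \<le> Mm"
    and u: "lsc_on (cball 0 1) u" and vp: "visc_super lam Lam (OmegaP \<psi>) fp u"
    and vm: "visc_super lam Lam (OmegaM \<psi>) fm u" and vt: "visc_transmission \<psi> g u"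
    and G: "0 \<le> G" "\<And>x. x \<in> Gamma \<psi> \<Longrightarrow> 2 * B * g x < G"
    and m0: "\<And>x. x \<in> sphere 0 1 \<Longrightarrow> - m0 \<le> u x"
    and M: "x1 \<in> cball 0 1" "u x1 \<le> - m0 - M"
    and R: "0 \<le> R" "2 * R < M - G * (B + B * B)" and \<epsilon>: "0 < \<epsilon>"
  defines "c \<equiv> barrier_const lam Lam (real n) * G + 2 * \<epsilon>"
  shows "R ^ n \<le> (9 * real n / lam) ^ n * (2 ^ n *
      ((LINT x:OmegaP \<psi>|lborel. (max 0 (fp x)) ^ n) + (LINT x:OmegaM \<psi>|lborel. (max 0 (fm x)) ^ n)
        + c ^ n * measure lborel (cball (0 :: real^('m option)) 1)))"
proof -
  let ?P = "OmegaP \<psi>" and ?M = "OmegaM \<psi>"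
  define \<Omega> where "\<Omega> = ?P \<union> ?M"
  define v where "v x = u x + (m0 - G * W x)" for x
  define bc where "bc = barrier_const lam Lam (real n)"
  define F where "F x = (if x \<in> ?P then max 0 (fp x) else max 0 (fm x)) + bc * G" for x
  define kap where "kap = lam / (2 * Lam * real n)"
  have n: "0 < n" "1 \<le> real n" by (simp_all add: n_def)
  have L: "0 < Lam" using lam by simp
  have bc: "0 \<le> bc" unfolding bc_def using n by (intro barrier_const_nonneg lam L) auto
  have c0: "0 \<le> c" using bc G(1) \<epsilon> by (simp add: c_def bc_def[symmetric])
  have kap: "0 < kap" "kap \<le> 1"
  proof -
    show "0 < kap" using lam L n by (simp add: kap_def)
    have "Lam * 1 \<le> Lam * (2 * real n)" using n L by (intro mult_left_mono) auto
    moreover have "Lam * (2 * real n) = 2 * Lam * real n" by simp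
    ultimately have "lam \<le> 2 * Lam * real n" using lam by linarith
    then show "kap \<le> 1" using L n by (simp add: kap_def divide_le_eq)
  qed
  have sub: "\<Omega> \<subseteq> ball 0 1" "?P \<subseteq> ball 0 1" "?M \<subseteq> ball 0 1" by (auto simp: \<Omega>_def OmegaP_eq OmegaM_eq)
  have disj: "x \<in> ?M \<Longrightarrow> x \<notin> ?P" for x by (auto simp: OmegaP_eq OmegaM_eq)
  have op: "open \<Omega>" unfolding \<Omega>_def using open_OmegaP open_OmegaM by blast
  have v: "lsc_on (cball 0 1) v" unfolding v_def
    by (intro lsc_on_add_continuous u continuous_intros W_continuous)
  have FP: "F x = max 0 (fp x) + bc * G" if "x \<in> ?P" for x using that by (simp add: F_def)
  have FM: "F x = max 0 (fm x) + bc * G" if "x \<in> ?M" for x using disj[OF that] by (simp add: F_def)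
  have F_cont: "continuous_on \<Omega> F" unfolding \<Omega>_def
  proof (rule continuous_on_open_Un[OF open_OmegaP open_OmegaM])
    have "continuous_on ?P (\<lambda>x. max 0 (fp x) + bc * G)" by (intro continuous_intros fp)
    then show "continuous_on ?P F" using FP by (simp cong: continuous_on_cong)
    have "continuous_on ?M (\<lambda>x. max 0 (fm x) + bc * G)" by (intro continuous_intros fm)
    then show "continuous_on ?M F" using FM by (simp cong: continuous_on_cong)
  qed
  have F0: "0 \<le> F x" for x using bc G(1) by (simp add: F_def)
  have Fb: "F x \<le> \<bar>Mp\<bar> + \<bar>Mm\<bar> + bc * G" if "x \<in> \<Omega>" for x
    using that fp(2)[of x] fm(2)[of x] by (auto simp: \<Omega>_def F_def)
  have int: "set_integrable lborel \<Omega> (\<lambda>x. (F x + 2 * \<epsilon>) ^ CARD('m option))"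
  proof (rule set_integrable_continuous_bounded[OF op sub(1)])
    show "continuous_on \<Omega> (\<lambda>x. (F x + 2 * \<epsilon>) ^ CARD('m option))" by (intro continuous_intros F_cont)
    show "\<bar>(F x + 2 * \<epsilon>) ^ CARD('m option)\<bar> \<le> (\<bar>Mp\<bar> + \<bar>Mm\<bar> + bc * G + 2 * \<epsilon>) ^ CARD('m option)" if "x \<in> \<Omega>" for x
      unfolding power_abs using F0[of x] Fb[OF that] \<epsilon> by (intro power_mono) auto
  qed
  have est: "R ^ CARD('m option) \<le> (9 * real CARD('m option) / lam) ^ CARD('m option)
      * (LINT x:\<Omega>|lborel. (F x + 2 * \<epsilon>) ^ CARD('m option))"
  proof (rule contact_measure_estimate[OF v lam(1) kap op sub(1) F_cont F0 \<epsilon> int _ R(1)])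
    fix z p e A \<delta>
    assume z: "z \<in> \<Omega>" and A: "0 < A" "norm e = 1" "0 < \<delta>"
      and t: "\<And>y. y \<in> ball z \<delta> \<Longrightarrow> v z + p \<bullet> (y - z) + A * ((e \<bullet> (y - z))\<^sup>2 - kap * ((y - z) \<bullet> (y - z))) \<le> v y"
    note t' = t[unfolded v_def kap_def n_def]
    show "A * lam \<le> F z"
    proof (cases "z \<in> ?P")
      case True
      have "A * lam \<le> fp z + bc * G" unfolding bc_def n_def
        by (rule visc_super_minus_barrier[OF lam open_OmegaP vp True G(1) A t'])
      then show ?thesis using FP[OF True] by simp
    next
      case False
      then have zM: "z \<in> ?M" using z by (simp add: \<Omega>_def)
      have "A * lam \<le> fm z + bc * G" unfolding bc_def n_def
        by (rule visc_super_minus_barrier[OF lam open_OmegaM vm zM G(1) A t'])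
      then show ?thesis using FM[OF zM] by simp
    qed
  next
    fix p :: "real^('m option)" assume "p \<in> cball 0 R"
    have "lsc_on (cball 0 1) (\<lambda>x. v x + - (p \<bullet> x))"
      by (intro lsc_on_add_continuous v continuous_intros)
    from lsc_on_attains_inf[OF compact_cball _ this] obtain x where
      x: "x \<in> cball 0 1" "\<And>y. y \<in> cball 0 1 \<Longrightarrow> v x + - (p \<bullet> x) \<le> v y + - (p \<bullet> y)" by auto
    have "v x + p \<bullet> (y - x) \<le> v y" if "y \<in> cball 0 1" for y
      using x(2)[OF that] by (simp add: inner_diff_right)
    then show "\<exists>x. contact v x p" using x(1) by (auto simp: contact_def)
  next
    fix x p assume p: "p \<in> cball 0 R" and ct: "contact v x p"
    have xc: "x \<in> cball 0 1" using ct by (simp add: contact_def)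
    \<comment> \<open>On the sphere \<open>v\<close> is at least \<open>- (G * (B + B * B))\<close>,
      at \<open>x1\<close> it is at most \<open>- M\<close>, and a plane of slope at most
      \<open>R\<close> varies by at most \<open>2 * R\<close> over the ball.\<close>
    have "x \<notin> sphere 0 1"
    proof
      assume xs: "x \<in> sphere 0 1"
      have "G * W x \<le> G * (B + B * B)" using W_le G(1) by (rule mult_left_mono)
      then have "- (G * (B + B * B)) \<le> v x" using m0[OF xs] by (simp add: v_def)
      moreover have "v x + p \<bullet> (x1 - x) \<le> v x1" using ct M(1) by (simp add: contact_def)
      moreover have "v x1 \<le> - M" using M(2) mult_nonneg_nonneg[OF G(1) W_nonneg[of x1]] by (simp add: v_def)
      moreover have "\<bar>p \<bullet> (x1 - x)\<bar> \<le> R * 2"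
      proof -
        have "\<bar>p \<bullet> (x1 - x)\<bar> \<le> norm p * norm (x1 - x)" by (rule Cauchy_Schwarz_ineq2)
        also have "\<dots> \<le> R * 2"
          using p M(1) xc norm_triangle_ineq4[of x1 x] R(1) by (intro mult_mono) auto
        finally show ?thesis .
      qed
      ultimately show False using R(2) by linarith
    qed
    then have xb: "x \<in> ball 0 1" using xc by auto
    have "x \<notin> Gamma \<psi>"
      using no_contact_on_Gamma[OF vt G, where k = m0] ct unfolding v_def by blast
    then show "x \<in> \<Omega>" using xb by (auto simp: \<Omega>_def OmegaP_eq OmegaM_eq Gamma_eq)
  qed
  have intP: "integrable lborel (\<lambda>x. indicator ?P x *\<^sub>R (max 0 (fp x)) ^ n)"
    unfolding set_integrable_def[symmetric]
  proof (rule set_integrable_continuous_bounded[OF open_OmegaP sub(2)])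
    show "continuous_on ?P (\<lambda>x. (max 0 (fp x)) ^ n)" by (intro continuous_intros fp)
    show "\<bar>(max 0 (fp x)) ^ n\<bar> \<le> \<bar>Mp\<bar> ^ n" if "x \<in> ?P" for x
      unfolding power_abs using fp(2)[OF that] by (intro power_mono) auto
  qed
  have intM: "integrable lborel (\<lambda>x. indicator ?M x *\<^sub>R (max 0 (fm x)) ^ n)"
    unfolding set_integrable_def[symmetric]
  proof (rule set_integrable_continuous_bounded[OF open_OmegaM sub(3)])
    show "continuous_on ?M (\<lambda>x. (max 0 (fm x)) ^ n)" by (intro continuous_intros fm)
    show "\<bar>(max 0 (fm x)) ^ n\<bar> \<le> \<bar>Mm\<bar> ^ n" if "x \<in> ?M" for x
      unfolding power_abs using fm(2)[OF that] by (intro power_mono) auto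
  qed
  have intB: "integrable lborel (\<lambda>x :: real^('m option). c ^ n * indicator (cball 0 1) x)"
    by (intro integrable_mult_right) (simp add: integrable_indicator_iff emeasure_bounded_finite[OF bounded_cball, simplified])
  \<comment> \<open>Separates the data from the constant \<open>c\<close>; bounding the sum by twice
    the maximum is the origin of the factor \<open>2 ^ n\<close>.\<close>
  have pw: "(a + c) ^ n \<le> 2 ^ n * (a ^ n + c ^ n)" if a: "0 \<le> a" for a
  proof -
    have "(a + c) ^ n \<le> (2 * max a c) ^ n" using a c0 by (intro power_mono) auto
    also have "\<dots> = 2 ^ n * max a c ^ n" by (simp add: power_mult_distrib)
    also have "max a c ^ n \<le> a ^ n + c ^ n" using a c0 by (simp add: max_def)
    finally show ?thesis by simp
  qed
  have "(LINT x:\<Omega>|lborel. (F x + 2 * \<epsilon>) ^ n) \<le> (LINT x|lborel. 2 ^ n *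
      (indicator ?P x *\<^sub>R (max 0 (fp x)) ^ n + indicator ?M x *\<^sub>R (max 0 (fm x)) ^ n + c ^ n * indicator (cball 0 1) x))"
    unfolding set_lebesgue_integral_def
  proof (rule integral_mono)
    show "integrable lborel (\<lambda>x. indicator \<Omega> x *\<^sub>R (F x + 2 * \<epsilon>) ^ n)"
      using int by (simp add: set_integrable_def n_def)
    show "integrable lborel (\<lambda>x. 2 ^ n * (indicator ?P x *\<^sub>R (max 0 (fp x)) ^ n + indicator ?M x *\<^sub>R (max 0 (fm x)) ^ n
        + c ^ n * indicator (cball 0 1) x))"
      by (intro integrable_mult_right Bochner_Integration.integrable_add intP intM intB)
    fix x :: "real^('m option)"
    consider "x \<in> ?P" | "x \<in> ?M" | "x \<notin> \<Omega>" by (auto simp: \<Omega>_def)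
    then show "indicator \<Omega> x *\<^sub>R (F x + 2 * \<epsilon>) ^ n \<le> 2 ^ n *
      (indicator ?P x *\<^sub>R (max 0 (fp x)) ^ n + indicator ?M x *\<^sub>R (max 0 (fm x)) ^ n + c ^ n * indicator (cball 0 1) x)"
    proof cases
      case 1
      then have "x \<notin> ?M" "x \<in> \<Omega>" "x \<in> cball 0 1" using disj sub by (auto simp: \<Omega>_def)
      then show ?thesis using 1 pw[of "max 0 (fp x)"] FP[OF 1] by (simp add: c_def bc_def add.assoc)
    next
      case 2
      then have "x \<notin> ?P" "x \<in> \<Omega>" "x \<in> cball 0 1" using disj sub by (auto simp: \<Omega>_def)
      then show ?thesis using 2 pw[of "max 0 (fm x)"] FM[OF 2] by (simp add: c_def bc_def add.assoc)
    next
      case 3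
      then show ?thesis using c0 by (auto simp: indicator_def \<Omega>_def)
    qed
  qed
  also have "\<dots> = 2 ^ n * ((LINT x:?P|lborel. (max 0 (fp x)) ^ n) + (LINT x:?M|lborel. (max 0 (fm x)) ^ n)
        + c ^ n * measure lborel (cball (0 :: real^('m option)) 1))"
    unfolding set_lebesgue_integral_def using intP intM intB
    by (simp add: Bochner_Integration.integral_add)
  finally have le: "(LINT x:\<Omega>|lborel. (F x + 2 * \<epsilon>) ^ n) \<le> \<dots>" .
  show ?thesis
    by (rule order_trans[OF est[folded n_def] mult_left_mono[OF le]]) (use lam in simp)
qed

end

section \<open>From powers of norms to the depth of \<open>u\<close>\<close>

lemma power_add_superadditive:
  fixes a b :: real
  assumes ab: "0 \<le> a" "0 \<le> b" and n: "0 < n"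
  shows "a ^ n + b ^ n \<le> (a + b) ^ n"
  using n
proof (induction n rule: nat_induct_non_zero)
  case 1
  then show ?case by simp
next
  case (Suc n)
  have "a * a ^ n + b * b ^ n \<le> (a + b) * a ^ n + (a + b) * b ^ n"
    using ab by (intro add_mono mult_right_mono) auto
  also have "\<dots> = (a + b) * (a ^ n + b ^ n)" by (simp only: distrib_left)
  also have "\<dots> \<le> (a + b) * (a + b) ^ n" using Suc ab by (intro mult_left_mono) auto
  finally show ?case by simp
qed

lemma Ln_norm_pos_nonneg: "0 \<le> Ln_norm_pos \<Omega> f"
  unfolding Ln_norm_pos_def by (rule powr_ge_zero)

lemma Ln_norm_pos_power:
  fixes f :: "real^'n::finite \<Rightarrow> real"
  shows "Ln_norm_pos \<Omega> f ^ CARD('n) = (LINT x:\<Omega>|lborel. (max 0 (f x)) ^ CARD('n))" (is "_ = ?I")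
proof -
  have "0 \<le> ?I" unfolding set_lebesgue_integral_def
    by (rule Bochner_Integration.integral_nonneg) simp
  then show ?thesis
    by (cases "?I = 0") (simp_all add: Ln_norm_pos_def powr_realpow[symmetric] powr_powr power_0_left)
qed

context C1alpha_interface
begin

text \<open>With \<open>G' = 2 * B * G\<close> in front of \<open>W\<close>, the first summand is
  the loss from the bound \<open>W \<le> B + B * B\<close>, and
  \<open>barrier_const lam Lam n * (2 * B)\<close> is the loss in the equation. The 36 is 9 from the
  slope estimate, 2 from splitting the \<open>n\<close>-th power and 2 from the diameter.\<close>

definition depth_const :: "real \<Rightarrow> real \<Rightarrow> real \<Rightarrow> real \<Rightarrow> real" where
  "depth_const lam Lam n V =
     2 * B * (B + B * B) + 36 * n / lam * (1 + V * (barrier_const lam Lam n * (2 * B)))"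

lemma depth_estimate:
  fixes u fp fm :: "real^('m option) \<Rightarrow> real"
  defines "n \<equiv> CARD('m option)"
  defines "V \<equiv> max 1 (measure lborel (cball (0 :: real^('m option)) 1))"
  assumes lam: "0 < lam" "lam \<le> Lam"
    and fp: "continuous_on (OmegaP \<psi>) fp" "\<And>x. x \<in> OmegaP \<psi> \<Longrightarrow> \<bar>fp x\<bar> \<le> Mp"
    and fm: "continuous_on (OmegaM \<psi>) fm" "\<And>x. x \<in> OmegaM \<psi> \<Longrightarrow> \<bar>fm x\<bar> \<le> Mm"
    and u: "lsc_on (cball 0 1) u" and vp: "visc_super lam Lam (OmegaP \<psi>) fp u"
    and vm: "visc_super lam Lam (OmegaM \<psi>) fm u" and vt: "visc_transmission \<psi> g u"
    and g: "0 \<le> G" "\<And>x. x \<in> Gamma \<psi> \<Longrightarrow> g x \<le> G"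
    and m0: "\<And>x. x \<in> sphere 0 1 \<Longrightarrow> - m0 \<le> u x"
    and M: "x1 \<in> cball 0 1" "u x1 \<le> - m0 - M"
  shows "M \<le> depth_const lam Lam (real n) V * (G + Ln_norm_pos (OmegaM \<psi>) fm + Ln_norm_pos (OmegaP \<psi>) fp)"
proof -
  let ?P = "Ln_norm_pos (OmegaP \<psi>) fp" and ?M = "Ln_norm_pos (OmegaM \<psi>) fm"
  define bc where "bc = barrier_const lam Lam (real n)"
  define a where "a = 18 * real n / lam"
  have n: "0 < n" "0 < real n" by (simp_all add: n_def)
  have bc: "0 \<le> bc" unfolding bc_def using lam n by (intro barrier_const_nonneg) auto
  have a: "0 \<le> a" using lam n by (simp add: a_def)
  have V: "1 \<le> V" "measure lborel (cball (0 :: real^('m option)) 1) \<le> V" by (simp_all add: V_def)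
  have P0: "0 \<le> ?P" "0 \<le> ?M" by (rule Ln_norm_pos_nonneg)+
  have step: "M \<le> 2 * B * (G + \<epsilon>) * (B + B * B) + 2 * (a * (?P + ?M + V * (bc * (2 * B * (G + \<epsilon>)) + 2 * \<epsilon>)))"
    if \<epsilon>: "0 < \<epsilon>" for \<epsilon>
  proof (rule ccontr)
    \<comment> \<open>The added \<open>\<epsilon>\<close> makes the bound on
      \<open>2 * B * g x\<close> strict, as \<open>no_contact_on_Gamma\<close> requires.\<close>
    define G' where "G' = 2 * B * (G + \<epsilon>)"
    define c where "c = bc * G' + 2 * \<epsilon>"
    define r where "r = a * (?P + ?M + V * c)"
    assume "\<not> ?thesis"
    then have "G' * (B + B * B) + 2 * r < M" by (simp add: G'_def c_def r_def)
    \<comment> \<open>A depth beyond the claimed bound leaves room for an admissible radius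
      \<open>R > r\<close>, while the volume estimate yields
      \<open>R ^ n \<le> r ^ n\<close>.\<close>
    then have "r < (M - G' * (B + B * B)) / 2" by simp
    then obtain R where "r < R" "R < (M - G' * (B + B * B)) / 2" using dense by blast
    then have R: "r < R" "2 * R < M - G' * (B + B * B)" by simp_all
    have G': "0 \<le> G'" using B_pos g(1) \<epsilon> by (simp add: G'_def)
    have gG: "2 * B * g x < G'" if "x \<in> Gamma \<psi>" for x
      using g(2)[OF that] \<epsilon> B_pos by (simp add: G'_def)
    have c0: "0 \<le> c" using bc G' \<epsilon> by (simp add: c_def)
    have r0: "0 \<le> r" using a P0 V c0 by (simp add: r_def)
    have R0: "0 \<le> R" using R(1) r0 by linarith
    have "R ^ n \<le> (9 * real n / lam) ^ n * (2 ^ n * (?P ^ n + ?M ^ n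
        + c ^ n * measure lborel (cball (0 :: real^('m option)) 1)))"
      using slope_radius_estimate[OF lam fp fm u vp vm vt G' gG m0 M R0 R(2) \<epsilon>]
      unfolding n_def c_def bc_def Ln_norm_pos_power .
    also have "\<dots> = a ^ n * (?P ^ n + ?M ^ n + c ^ n * measure lborel (cball (0 :: real^('m option)) 1))"
    proof -
      have "a = 9 * real n / lam * 2" by (simp add: a_def)
      then have "a ^ n = (9 * real n / lam) ^ n * 2 ^ n" by (simp only: power_mult_distrib)
      then show ?thesis by (simp only: mult.assoc)
    qed
    also have "\<dots> \<le> a ^ n * (?P + ?M + V * c) ^ n"
    proof (intro mult_left_mono)
      \<comment> \<open>\<open>V \<ge> 1\<close> gives \<open>V \<le> V ^ n\<close>, which moves the
        volume inside the \<open>n\<close>-th power without extracting a root.\<close>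
      have "measure lborel (cball (0 :: real^('m option)) 1) \<le> V ^ n"
        using V self_le_power[OF V(1) n(1)] by linarith
      then have "c ^ n * measure lborel (cball (0 :: real^('m option)) 1) \<le> c ^ n * V ^ n"
        using c0 by (intro mult_left_mono) auto
      then have "c ^ n * measure lborel (cball (0 :: real^('m option)) 1) \<le> (V * c) ^ n"
        by (simp only: power_mult_distrib mult.commute)
      moreover have "?P ^ n + ?M ^ n \<le> (?P + ?M) ^ n" by (rule power_add_superadditive[OF P0 n(1)])
      moreover have "(?P + ?M) ^ n + (V * c) ^ n \<le> (?P + ?M + V * c) ^ n"
        using P0 V c0 by (intro power_add_superadditive n) auto
      ultimately show "?P ^ n + ?M ^ n + c ^ n * measure lborel (cball (0 :: real^('m option)) 1) \<le> (?P + ?M + V * c) ^ n"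
        by linarith
    qed (use a in simp)
    also have "\<dots> = r ^ n" by (simp add: r_def power_mult_distrib)
    finally have "R ^ n \<le> r ^ n" .
    moreover have "r ^ n < R ^ n" using R(1) r0 n(1) by (rule power_strict_mono)
    ultimately show False by simp
  qed
  \<comment> \<open>The total coefficient of \<open>\<epsilon>\<close> in
    \<open>step\<close>.\<close>
  define k where "k = 2 * B * (B + B * B) + 2 * a * V * (bc * (2 * B) + 2)"
  have k: "0 \<le> k" using B_pos a V bc by (simp add: k_def)
  have "M \<le> 2 * B * (B + B * B) * G + 2 * a * (?P + ?M + V * (bc * (2 * B)) * G)"
  proof (rule field_le_epsilon)
    fix e :: real assume e: "0 < e"
    define \<epsilon> where "\<epsilon> = e / (k + 1)"
    have \<epsilon>: "0 < \<epsilon>" using e k by (simp add: \<epsilon>_def)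
    have "\<epsilon> * k \<le> e" using e k by (simp add: \<epsilon>_def divide_le_eq)
    moreover have "2 * B * (G + \<epsilon>) * (B + B * B) + 2 * (a * (?P + ?M + V * (bc * (2 * B * (G + \<epsilon>)) + 2 * \<epsilon>)))
        = 2 * B * (B + B * B) * G + 2 * a * (?P + ?M + V * (bc * (2 * B)) * G) + \<epsilon> * k"
      unfolding k_def by (simp add: algebra_simps)
    ultimately show "M \<le> 2 * B * (B + B * B) * G + 2 * a * (?P + ?M + V * (bc * (2 * B)) * G) + e"
      using step[OF \<epsilon>] by linarith
  qed
  \<comment> \<open>\<open>S\<close> stands for the full right-hand side \<open>G + ?M + ?P\<close>,
    which dominates both \<open>G\<close> and the sum of the two norms.\<close>
  also have "\<dots> \<le> 2 * B * (B + B * B) * S + 2 * a * (S + V * (bc * (2 * B)) * S)"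
    if "?P + ?M \<le> S" "G \<le> S" for S
    using B_pos a V bc that by (intro add_mono mult_left_mono) auto
  also have "2 * B * (B + B * B) * S + 2 * a * (S + V * (bc * (2 * B)) * S) = depth_const lam Lam (real n) V * S" for S
    unfolding depth_const_def bc_def[symmetric] a_def by (simp add: distrib_left distrib_right)
  finally show ?thesis using P0 g(1) by simp
qed

end

text \<open>Boundedness of the quotients makes their \<open>Sup\<close> an upper bound. That it is
  nonnegative needs two distinct points of the ball; 0 and a unit vector serve.\<close>

lemma C1alpha_interfaceI:
  fixes \<psi> :: "real^'m::finite \<Rightarrow> real"
  assumes \<alpha>: "0 < \<alpha>" "\<alpha> < 1" and \<psi>: "C1alpha_cball \<alpha> \<psi>" "C1alpha_seminorm \<alpha> \<psi> = s"
  shows "C1alpha_interface \<alpha> s \<psi>"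
proof -
  let ?g = "grad_within \<psi> (cball 0 1)"
  define S where "S = {norm (?g x - ?g y) / dist x y powr \<alpha> | x y. x \<in> cball 0 1 \<and> y \<in> cball 0 1 \<and> x \<noteq> y}"
  obtain K where "\<forall>x\<in>cball 0 1. \<forall>y\<in>cball 0 1. x \<noteq> y \<longrightarrow> norm (?g x - ?g y) / dist x y powr \<alpha> \<le> K"
    using \<psi>(1) unfolding C1alpha_cball_def by blast
  then have "bdd_above S" unfolding S_def by (intro bdd_aboveI[of _ K]) blast
  then have up: "t \<le> s" if "t \<in> S" for t
    using cSup_upper[OF that] \<psi>(2) by (simp add: C1alpha_seminorm_def S_def)
  have holder: "norm (?g x - ?g y) / dist x y powr \<alpha> \<le> s" if "x \<in> cball 0 1" "y \<in> cball 0 1" "x \<noteq> y" for x y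
    using that by (intro up) (auto simp: S_def)
  obtain b :: "real^'m" where b: "norm b = 1" using vector_choose_size[of 1] by auto
  have "0 \<le> norm (?g b - ?g 0) / dist b 0 powr \<alpha>" by simp
  also have "\<dots> \<le> s" using b by (intro holder) auto
  finally have s: "0 \<le> s" .
  show ?thesis
  proof
    fix y z :: "real^'m" assume yz: "y \<in> cball 0 1" "z \<in> cball 0 1"
    show "norm (?g y - ?g z) \<le> s * dist y z powr \<alpha>"
    proof (cases "y = z")
      case False
      then show ?thesis using holder[OF yz False] by (simp add: divide_le_eq)
    qed simp
  qed (use \<alpha> s \<psi>(1) in \<open>auto simp: C1alpha_cball_def\<close>)
qed

theorem mainTheorem4:
  fixes \<alpha> lam Lam s :: real
  assumes "0 < \<alpha>" "\<alpha> < 1" "0 < lam" "lam \<le> Lam"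
  shows "\<exists>C>0. \<forall>(\<psi>::real^'m::finite \<Rightarrow> real) (u::real^('m option) \<Rightarrow> real) fp fm g.
     C1alpha_cball \<alpha> \<psi> \<and> C1alpha_seminorm \<alpha> \<psi> = s \<and>
     continuous_on (OmegaP \<psi>) fp \<and> (\<exists>M. \<forall>x\<in>OmegaP \<psi>. \<bar>fp x\<bar> \<le> M) \<and>
     continuous_on (OmegaM \<psi>) fm \<and> (\<exists>M. \<forall>x\<in>OmegaM \<psi>. \<bar>fm x\<bar> \<le> M) \<and>
     (\<exists>M. \<forall>x\<in>Gamma \<psi>. \<bar>g x\<bar> \<le> M) \<and>
     lsc_on (cball 0 1) u \<and>
     visc_super lam Lam (OmegaP \<psi>) fp u \<and> visc_super lam Lam (OmegaM \<psi>) fm u \<and>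
     visc_transmission \<psi> g u
     \<longrightarrow> Sup ((\<lambda>x. max 0 (- u x)) ` ball 0 1)
         \<le> Sup ((\<lambda>x. max 0 (- u x)) ` sphere 0 1)
            + C * (Sup (insert 0 ((\<lambda>x. max 0 (g x)) ` Gamma \<psi>))
                   + Ln_norm_pos (OmegaM \<psi>) fm + Ln_norm_pos (OmegaP \<psi>) fp)"
proof -
  define V where "V = max 1 (measure lborel (cball (0 :: real^('m option)) 1))"
  \<comment> \<open>Seen from outside the locale the constant takes only \<alpha> and
    \<open>s\<close> of the locale parameters, since \<open>B\<close>, \<open>K\<close> and
    \<open>barrier_const\<close> do not involve \<psi>. Hence it can be fixed before \<psi> is
    given.\<close>
  define C0 where "C0 = C1alpha_interface.depth_const \<alpha> s lam Lam (real CARD('m option)) V"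
  define C where "C = max 1 C0"
  show ?thesis
  proof (intro exI[of _ C] conjI allI impI; (elim conjE exE)?)
    show "0 < C" by (simp add: C_def)
    fix \<psi> :: "real^'m \<Rightarrow> real" and u :: "real^('m option) \<Rightarrow> real" and fp fm g Mp Mm Mg
    assume \<psi>: "C1alpha_cball \<alpha> \<psi>" "C1alpha_seminorm \<alpha> \<psi> = s"
      and fp: "continuous_on (OmegaP \<psi>) fp" "\<forall>x\<in>OmegaP \<psi>. \<bar>fp x\<bar> \<le> Mp"
      and fm: "continuous_on (OmegaM \<psi>) fm" "\<forall>x\<in>OmegaM \<psi>. \<bar>fm x\<bar> \<le> Mm"
      and g: "\<forall>x\<in>Gamma \<psi>. \<bar>g x\<bar> \<le> Mg"
      and u: "lsc_on (cball 0 1) u" "visc_super lam Lam (OmegaP \<psi>) fp u"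
        "visc_super lam Lam (OmegaM \<psi>) fm u" "visc_transmission \<psi> g u"
    interpret C1alpha_interface \<alpha> s \<psi> by (rule C1alpha_interfaceI[OF assms(1,2) \<psi>])
    define G where "G = Sup (insert 0 ((\<lambda>x. max 0 (g x)) ` Gamma \<psi>))"
    define m0 where "m0 = Sup ((\<lambda>x. max 0 (- u x)) ` sphere 0 1)"
    define T where "T = G + Ln_norm_pos (OmegaM \<psi>) fm + Ln_norm_pos (OmegaP \<psi>) fp"
    have "bdd_above (insert 0 ((\<lambda>x. max 0 (g x)) ` Gamma \<psi>))"
      using g by (intro bdd_aboveI[of _ "\<bar>Mg\<bar>"]) force
    note G_upper = cSup_upper[OF _ this, folded G_def]
    have G: "0 \<le> G" "\<And>x. x \<in> Gamma \<psi> \<Longrightarrow> g x \<le> G"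
    proof -
      show "0 \<le> G" by (rule G_upper) simp
      have "max 0 (g x) \<le> G" if "x \<in> Gamma \<psi>" for x by (rule G_upper) (use that in simp)
      then show "g x \<le> G" if "x \<in> Gamma \<psi>" for x using that by force
    qed
    obtain xmin where xmin: "\<And>x. x \<in> cball 0 1 \<Longrightarrow> u xmin \<le> u x"
      using lsc_on_attains_inf[OF compact_cball _ u(1)] by force
    \<comment> \<open>\<open>Sup\<close> of an unbounded set of reals carries no information; the
      minimum of the lower semicontinuous \<open>u\<close> over the closed ball provides the
      bound.\<close>
    have bdd: "bdd_above ((\<lambda>x. max 0 (- u x)) ` sphere 0 1)"
      using xmin by (intro bdd_aboveI2[of _ _ "max 0 (- u xmin)"] max.mono) auto
    have m0_ge: "max 0 (- u x) \<le> m0" if "x \<in> sphere 0 1" for x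
      unfolding m0_def using that by (intro cSup_upper bdd) auto
    obtain b :: "real^('m option)" where "norm b = 1" using vector_choose_size[of 1] by auto
    then have m0: "0 \<le> m0" using m0_ge[of b] by auto
    have T: "0 \<le> T" using G(1) by (simp add: T_def Ln_norm_pos_nonneg)
    have "max 0 (- u x) \<le> m0 + C * T" if x: "x \<in> ball 0 1" for x
    proof -
      \<comment> \<open>Each point of the ball serves as \<open>x1\<close>, with depth
        \<open>M = - u x - m0\<close>; no lowest point is singled out, and the depth may be
        negative.\<close>
      have "- u x - m0 \<le> C0 * T" unfolding C0_def T_def V_def
      proof (rule depth_estimate[OF assms(3,4) fp(1) _ fm(1) _ u G])
        show "- m0 \<le> u y" if "y \<in> sphere 0 1" for y using m0_ge[OF that] by simp
      qed (use fp(2) fm(2) x in auto)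
      also have "\<dots> \<le> C * T" using T by (intro mult_right_mono) (auto simp: C_def)
      finally have "- u x \<le> m0 + C * T" by simp
      moreover have "0 \<le> C * T" using T by (simp add: C_def)
      ultimately show ?thesis using m0 by simp
    qed
    then have "Sup ((\<lambda>x. max 0 (- u x)) ` ball 0 1) \<le> m0 + C * T" by (intro cSup_least) auto
    then show "Sup ((\<lambda>x. max 0 (- u x)) ` ball 0 1) \<le> Sup ((\<lambda>x. max 0 (- u x)) ` sphere 0 1)
        + C * (Sup (insert 0 ((\<lambda>x. max 0 (g x)) ` Gamma \<psi>))
               + Ln_norm_pos (OmegaM \<psi>) fm + Ln_norm_pos (OmegaP \<psi>) fp)"
      by (simp only: m0_def T_def G_def)
  qed
qed

end
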